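(* Let $n\ge 3$ and let $\mathbf{y}^1,\dots,\mathbf{y}^n$ be i.i.d. random sequences from the complex sequence space $\ell_2$. Let $M>0$ be such that $\|\mathbf{y}^i\|_2\le M$ almost surely for all $i=1,\dots,n$. Put $\mathbf{\Lambda}:=\mathbb{E}\,\mathbf{y}^i\otimes\mathbf{y}^i$ and assume that $\|\mathbf{\Lambda}\|_{2\to2}\le 1$. Then for every $0<t\le 1$ $$\mathbb{P}\Big(\Big\|\frac1n\sum_{i=1}^n \mathbf{y}^i\otimes\mathbf{y}^i-\mathbf{\Lambda}\Big\|_{2\to2}\ge t\Big)\le 2^{3/4}\,n\,\exp\Big(-\frac{t^2n}{21M^2}\Big).$$
   Context: For a (column) sequence $\mathbf{y}\in\ell_2$, $\mathbf{y}\otimes\mathbf{y}:=\mathbf{y}\,\mathbf{y}^*=\mathbf{y}\,\overline{\mathbf{y}}^{\top}$ is the rank-one operator on $\ell_2$ (infinite matrix with entries $y_j\overline{y_k}$). $\|\cdot\|_{2\to2}$ is the operator (spectral) norm on $\ell_2$. *)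

theory Defs
  imports "HOL-Probability.Probability"
begin

section \<open>The complex sequence space\<close>

typedef ell2 = "{x :: nat \<Rightarrow> complex. summable (\<lambda>k. (cmod (x k))\<^sup>2)}"
  morphisms coord Abs_ell2
  by (rule exI[of _ "\<lambda>_. 0"]) simp

setup_lifting type_definition_ell2

lemma summable_coord: "summable (\<lambda>k. (cmod (coord x k))\<^sup>2)"
  using coord[of x] by simp

lemma ell2_eqI: "(\<And>k. coord x k = coord y k) \<Longrightarrow> x = y"
  by (simp add: coord_inject[symmetric] fun_eq_iff)

lemma sq_summable_add:
  fixes x y :: "nat \<Rightarrow> complex"
  assumes "summable (\<lambda>k. (cmod (x k))\<^sup>2)" "summable (\<lambda>k. (cmod (y k))\<^sup>2)"
  shows "summable (\<lambda>k. (cmod (x k + y k))\<^sup>2)"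
proof (rule summable_comparison_test')
  show "summable (\<lambda>k. 2 * (cmod (x k))\<^sup>2 + 2 * (cmod (y k))\<^sup>2)"
    by (intro summable_add summable_mult assms)
  fix k
  have "(cmod (x k + y k))\<^sup>2 \<le> (cmod (x k) + cmod (y k))\<^sup>2"
    by (intro power_mono norm_triangle_ineq) simp
  also have "\<dots> \<le> 2 * (cmod (x k))\<^sup>2 + 2 * (cmod (y k))\<^sup>2"
    using sum_squares_bound[of "cmod (x k)" "cmod (y k)"] by (simp add: power2_sum)
  finally show "norm ((cmod (x k + y k))\<^sup>2) \<le> 2 * (cmod (x k))\<^sup>2 + 2 * (cmod (y k))\<^sup>2"
    by simp
qed

lemma summable_cmod_mult:
  fixes x y :: "nat \<Rightarrow> complex"
  assumes "summable (\<lambda>k. (cmod (x k))\<^sup>2)" "summable (\<lambda>k. (cmod (y k))\<^sup>2)"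
  shows "summable (\<lambda>k. cmod (x k) * cmod (y k))"
proof (rule summable_comparison_test')
  show "summable (\<lambda>k. (cmod (x k))\<^sup>2 + (cmod (y k))\<^sup>2)"
    by (intro summable_add assms)
  fix k
  show "norm (cmod (x k) * cmod (y k)) \<le> (cmod (x k))\<^sup>2 + (cmod (y k))\<^sup>2"
    using sum_squares_bound[of "cmod (x k)" "cmod (y k)"]
      mult_nonneg_nonneg[OF norm_ge_zero[of "x k"] norm_ge_zero[of "y k"]]
    unfolding real_norm_def abs_mult abs_norm_cancel by linarith
qed

lift_definition scaleC_ell2 :: "complex \<Rightarrow> ell2 \<Rightarrow> ell2" is "\<lambda>c x k. c * x k"
  by (simp add: norm_mult power_mult_distrib summable_mult)

instantiation ell2 :: real_vector
begin

lift_definition zero_ell2 :: ell2 is "\<lambda>_. 0" by simp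
lift_definition plus_ell2 :: "ell2 \<Rightarrow> ell2 \<Rightarrow> ell2" is "\<lambda>x y k. x k + y k"
  by (rule sq_summable_add)
lift_definition uminus_ell2 :: "ell2 \<Rightarrow> ell2" is "\<lambda>x k. - x k" by simp
lift_definition minus_ell2 :: "ell2 \<Rightarrow> ell2 \<Rightarrow> ell2" is "\<lambda>x y k. x k - y k"
  using sq_summable_add[of _ "\<lambda>k. - y k" for y] by simp
lift_definition scaleR_ell2 :: "real \<Rightarrow> ell2 \<Rightarrow> ell2" is "\<lambda>r x k. r *\<^sub>R x k"
  by (simp add: power_mult_distrib summable_mult)

instance
  by standard (transfer; simp add: algebra_simps fun_eq_iff)+

end

lemmas coord_simps [simp] =
  zero_ell2.rep_eq plus_ell2.rep_eq uminus_ell2.rep_eq minus_ell2.rep_eq scaleR_ell2.rep_eq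
  scaleC_ell2.rep_eq

lemma summable_inner_coord: "summable (\<lambda>k. inner (coord x k) (coord y k))"
  by (rule summable_comparison_test'[OF summable_cmod_mult[OF summable_coord[of x] summable_coord[of y]]])
    (simp add: Cauchy_Schwarz_ineq2)

text \<open>The norm is the usual one; the real inner product inducing it is the real part of the
  complex one (\<open>cinner_ell2\<close> below).\<close>

instantiation ell2 :: real_inner
begin

definition norm_ell2 :: "ell2 \<Rightarrow> real"
  where "norm_ell2 x = sqrt (\<Sum>k. (cmod (coord x k))\<^sup>2)"
definition inner_ell2 :: "ell2 \<Rightarrow> ell2 \<Rightarrow> real"
  where "inner_ell2 x y = (\<Sum>k. inner (coord x k) (coord y k))"
definition dist_ell2 :: "ell2 \<Rightarrow> ell2 \<Rightarrow> real"
  where "dist_ell2 x y = norm (x - y)"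
definition sgn_ell2 :: "ell2 \<Rightarrow> ell2"
  where "sgn_ell2 x = x /\<^sub>R norm x"
definition uniformity_ell2 :: "(ell2 \<times> ell2) filter"
  where "uniformity_ell2 = (INF e\<in>{0 <..}. principal {(x, y). dist x y < e})"
definition open_ell2 :: "ell2 set \<Rightarrow> bool"
  where "open_ell2 U = (\<forall>x\<in>U. \<forall>\<^sub>F (x', y) in uniformity. x' = x \<longrightarrow> y \<in> U)"

instance
proof
  fix x y z :: ell2 and r :: real and U :: "ell2 set"
  show "dist x y = norm (x - y)" by (rule dist_ell2_def)
  show "sgn x = x /\<^sub>R norm x" by (rule sgn_ell2_def)
  show "uniformity = (INF e\<in>{0 <..}. principal {(x :: ell2, y). dist x y < e})"
    by (rule uniformity_ell2_def)
  show "open U = (\<forall>x\<in>U. \<forall>\<^sub>F (x', y) in uniformity. x' = x \<longrightarrow> y \<in> U)"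
    by (rule open_ell2_def)
  show "inner x y = inner y x"
    by (simp add: inner_ell2_def inner_commute)
  show "inner (x + y) z = inner x z + inner y z"
    by (simp add: inner_ell2_def inner_add_left suminf_add summable_inner_coord)
  show "inner (r *\<^sub>R x) y = r * inner x y"
    by (simp add: inner_ell2_def suminf_mult summable_inner_coord)
  have sq: "inner x x = (\<Sum>k. (cmod (coord x k))\<^sup>2)"
    by (simp add: inner_ell2_def dot_square_norm)
  show "0 \<le> inner x x"
    unfolding sq by (intro suminf_nonneg summable_coord) simp
  show "norm x = sqrt (inner x x)"
    by (simp add: norm_ell2_def sq)
  have "inner x x = 0 \<longleftrightarrow> (\<forall>k. (cmod (coord x k))\<^sup>2 = 0)"
    unfolding sq by (intro suminf_eq_zero_iff summable_coord) simp
  then show "inner x x = 0 \<longleftrightarrow> x = 0"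
    by (auto intro: ell2_eqI)
qed

end

lemma norm_ell2_sq: "(norm (x :: ell2))\<^sup>2 = (\<Sum>k. (cmod (coord x k))\<^sup>2)"
  by (simp add: norm_ell2_def suminf_nonneg summable_coord)

lemma sum_le_norm_ell2: "(\<Sum>k<n. (cmod (coord x k))\<^sup>2) \<le> (norm x)\<^sup>2"
  unfolding norm_ell2_sq by (intro sum_le_suminf summable_coord) auto

lemma norm_ell2_leI:
  assumes "0 \<le> c" "\<And>n. (\<Sum>k<n. (cmod (coord x k))\<^sup>2) \<le> c\<^sup>2"
  shows "norm x \<le> c"
  by (rule power2_le_imp_le[OF _ assms(1)], unfold norm_ell2_sq)
    (intro suminf_le_const summable_coord assms(2))

lemma cmod_coord_le: "cmod (coord x k) \<le> norm x"
proof (rule power2_le_imp_le)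
  have "(cmod (coord x k))\<^sup>2 \<le> (\<Sum>j<Suc k. (cmod (coord x j))\<^sup>2)"
    by (simp add: sum_nonneg)
  also have "\<dots> \<le> (norm x)\<^sup>2" by (rule sum_le_norm_ell2)
  finally show "(cmod (coord x k))\<^sup>2 \<le> (norm x)\<^sup>2" .
qed simp

lemma bounded_linear_coord: "bounded_linear (\<lambda>x. coord x k)"
  by (rule bounded_linear_intro[where K = 1]) (auto simp: cmod_coord_le)

lemma norm_scaleC_ell2: "norm (scaleC_ell2 c x) = cmod c * norm x"
  by (simp add: norm_ell2_def norm_mult power_mult_distrib suminf_mult summable_coord
      real_sqrt_mult)

instance ell2 :: banach
proof
  fix X :: "nat \<Rightarrow> ell2"
  assume X: "Cauchy X"
  have "\<exists>l. (\<lambda>n. coord (X n) k) \<longlonglongrightarrow> l" for k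
    using bounded_linear.Cauchy[OF bounded_linear_coord X, of k]
    by (simp add: Cauchy_convergent_iff convergent_def)
  then obtain a where a: "\<And>k. (\<lambda>n. coord (X n) k) \<longlonglongrightarrow> a k" by metis
  have tail: "(\<Sum>k<K. (cmod (coord (X m) k - a k))\<^sup>2) \<le> e\<^sup>2"
    if "\<And>n. n \<ge> N \<Longrightarrow> norm (X m - X n) \<le> e" for e m N K
  proof (rule tendsto_le[OF _ tendsto_const])
    show "(\<lambda>n. \<Sum>k<K. (cmod (coord (X m) k - coord (X n) k))\<^sup>2)
        \<longlonglongrightarrow> (\<Sum>k<K. (cmod (coord (X m) k - a k))\<^sup>2)"
      by (intro tendsto_intros a)
    show "\<forall>\<^sub>F n in sequentially. (\<Sum>k<K. (cmod (coord (X m) k - coord (X n) k))\<^sup>2) \<le> e\<^sup>2"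
      unfolding eventually_sequentially
    proof (intro exI[of _ N] allI impI)
      fix n assume "N \<le> n"
      then have "(norm (X m - X n))\<^sup>2 \<le> e\<^sup>2"
        by (intro power_mono that) auto
      then show "(\<Sum>k<K. (cmod (coord (X m) k - coord (X n) k))\<^sup>2) \<le> e\<^sup>2"
        using sum_le_norm_ell2[where x = "X m - X n" and n = K] by simp
    qed
  qed simp
  have diff: "summable (\<lambda>k. (cmod (coord (X m) k - a k))\<^sup>2)"
    if "\<And>n. n \<ge> N \<Longrightarrow> norm (X m - X n) \<le> e" for e m N
    by (rule summableI_nonneg_bounded[where x = "e\<^sup>2"]) (simp, rule tail[OF that])
  obtain N0 where N0: "\<And>m n. m \<ge> N0 \<Longrightarrow> n \<ge> N0 \<Longrightarrow> norm (X m - X n) < 1"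
    using X unfolding Cauchy_iff by (meson zero_less_one)
  have "summable (\<lambda>k. (cmod (coord (X N0) k - a k))\<^sup>2)"
    by (rule diff[of N0 _ 1]) (use N0 in \<open>auto intro: less_imp_le\<close>)
  then have "summable (\<lambda>k. (cmod (a k - coord (X N0) k))\<^sup>2)"
    by (simp add: norm_minus_commute)
  from sq_summable_add[OF this summable_coord[of "X N0"]]
  have "summable (\<lambda>k. (cmod (a k))\<^sup>2)" by simp
  then have A: "coord (Abs_ell2 a) = a" by (simp add: Abs_ell2_inverse)
  have "X \<longlonglongrightarrow> Abs_ell2 a"
  proof (rule LIMSEQ_I)
    fix r :: real assume r: "0 < r"
    then obtain N where N: "\<And>m n. m \<ge> N \<Longrightarrow> n \<ge> N \<Longrightarrow> norm (X m - X n) < r / 2"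
      using X unfolding Cauchy_iff by (meson half_gt_zero)
    show "\<exists>no. \<forall>n\<ge>no. norm (X n - Abs_ell2 a) < r"
    proof (intro exI[of _ N] allI impI)
      fix m assume "N \<le> m"
      then have "norm (X m - Abs_ell2 a) \<le> r / 2"
        using r tail[of N m "r / 2", OF less_imp_le[OF N]]
        by (intro norm_ell2_leI) (simp_all add: A)
      then show "norm (X m - Abs_ell2 a) < r" using r by simp
    qed
  qed
  then show "convergent X" by (auto simp: convergent_def)
qed

lemma ell2_of_list_summable:
  "summable (\<lambda>k. (cmod (if k < length xs then xs ! k else 0))\<^sup>2)"
  by (rule summable_finite[of "{..<length xs}"]) auto

lift_definition ell2_of_list :: "complex list \<Rightarrow> ell2"
  is "\<lambda>xs k. if k < length xs then xs ! k else 0"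
  by (rule ell2_of_list_summable)

lemma ell2_countable_dense:
  "\<exists>D :: ell2 set. countable D \<and> (\<forall>x e. 0 < e \<longrightarrow> (\<exists>d\<in>D. dist x d < e))"
proof -
  obtain Q :: "complex set" where Q: "countable Q" "\<And>U. open U \<Longrightarrow> U \<noteq> {} \<Longrightarrow> \<exists>q\<in>Q. q \<in> U"
    using countable_dense_setE by metis
  have "\<exists>d\<in>ell2_of_list ` lists Q. dist x d < e" if e: "0 < e" for x :: ell2 and e
  proof -
    obtain K where K: "norm (\<Sum>k. (cmod (coord x (k + K)))\<^sup>2) < (e / 2)\<^sup>2"
      using suminf_exist_split[OF _ summable_coord[of x], of "(e / 2)\<^sup>2"] e by auto
    define h where "h = e / (2 * (real K + 1))"
    have h: "0 < h" using e by (simp add: h_def)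
    have "\<exists>q\<in>Q. dist (coord x k) q < h" for k
      using Q(2)[of "ball (coord x k) h"] h by auto
    then obtain q where q: "\<And>k. q k \<in> Q" "\<And>k. dist (coord x k) (q k) < h" by metis
    define d where "d = ell2_of_list (map q [0..<K])"
    have cd: "coord d k = (if k < K then q k else 0)" for k
      by (simp add: d_def ell2_of_list.rep_eq)
    have "(norm (x - d))\<^sup>2 = (\<Sum>k. (cmod (coord (x - d) (k + K)))\<^sup>2)
        + (\<Sum>k<K. (cmod (coord (x - d) k))\<^sup>2)"
      unfolding norm_ell2_sq by (rule suminf_split_initial_segment[OF summable_coord])
    also have "(\<Sum>k. (cmod (coord (x - d) (k + K)))\<^sup>2) \<le> (e / 2)\<^sup>2"
      using K by (simp add: cd)
    also have "(\<Sum>k<K. (cmod (coord (x - d) k))\<^sup>2) \<le> (\<Sum>k<K. h\<^sup>2)"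
      using q(2) by (intro sum_mono power_mono) (auto simp: cd dist_norm intro: less_imp_le)
    also have "\<dots> = real K * h\<^sup>2" by simp
    also have "\<dots> \<le> (real K + 1)\<^sup>2 * h\<^sup>2"
      by (intro mult_right_mono) (auto simp: power2_eq_square algebra_simps)
    also have "\<dots> = (e / 2)\<^sup>2"
    proof -
      have "(real K + 1) * h = e / 2"
        unfolding h_def by (simp add: divide_simps)
      then show ?thesis by (metis power_mult_distrib)
    qed
    finally have "(norm (x - d))\<^sup>2 \<le> (e / 2)\<^sup>2 + (e / 2)\<^sup>2" by simp
    also have "\<dots> < e\<^sup>2" using e by (simp add: power2_eq_square)
    finally have "norm (x - d) < e"
      by (rule power2_less_imp_less) (use e in simp)
    moreover have "d \<in> ell2_of_list ` lists Q"
      unfolding d_def by (intro imageI) (auto simp: in_lists_conv_set q(1))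
    ultimately show ?thesis by (auto simp: dist_norm)
  qed
  then show ?thesis
    using Q(1) by (intro exI[of _ "ell2_of_list ` lists Q"]) auto
qed

instance ell2 :: second_countable_topology
proof
  obtain D :: "ell2 set" where D: "countable D" "\<And>x e. 0 < e \<Longrightarrow> \<exists>d\<in>D. dist x d < e"
    using ell2_countable_dense by metis
  define B where "B = (\<lambda>(d, r). ball d r) ` (D \<times> (\<rat> :: real set))"
  have "topological_basis B"
  proof (rule topological_basisI)
    fix b assume "b \<in> B"
    then show "open b" by (auto simp: B_def)
  next
    fix U and x :: ell2 assume "open U" "x \<in> U"
    then obtain e where e: "0 < e" "ball x e \<subseteq> U" by (rule openE)
    obtain r where r: "r \<in> \<rat>" "0 < r" "r < e / 2" using Rats_dense_in_real[of 0 "e / 2"] e by auto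
    obtain d where d: "d \<in> D" "dist x d < r" using D(2) r by blast
    have "ball d r \<subseteq> ball x e"
    proof
      fix z assume "z \<in> ball d r"
      then show "z \<in> ball x e"
        using d r dist_triangle[of x z d] by simp
    qed
    with d r e show "\<exists>b\<in>B. x \<in> b \<and> b \<subseteq> U"
      by (intro bexI[of _ "ball d r"]) (auto simp: B_def dist_commute)
  qed
  moreover have "countable B"
    unfolding B_def by (intro countable_image countable_SIGMA D countable_rat)
  ultimately show "\<exists>B :: ell2 set set. countable B \<and> open = generate_topology B"
    using topological_basis_imp_subbasis by blast
qed

section \<open>Rank-one operators\<close>

text \<open>The complex inner product, conjugate-linear in its second argument.\<close>

definition cinner_ell2 :: "ell2 \<Rightarrow> ell2 \<Rightarrow> complex"
  where "cinner_ell2 x y = (\<Sum>k. coord x k * cnj (coord y k))"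

lemma summable_cinner_norm: "summable (\<lambda>k. cmod (coord x k * cnj (coord y k)))"
  using summable_cmod_mult[OF summable_coord[of x] summable_coord[of y]] by (simp add: norm_mult)

lemma summable_cinner: "summable (\<lambda>k. coord x k * cnj (coord y k))"
  by (rule summable_norm_cancel[OF summable_cinner_norm])

lemma cmod_cinner_ell2_le: "cmod (cinner_ell2 x y) \<le> norm x * norm y"
proof -
  have "cmod (cinner_ell2 x y) \<le> (\<Sum>k. cmod (coord x k * cnj (coord y k)))"
    unfolding cinner_ell2_def by (rule summable_norm[OF summable_cinner_norm])
  also have "\<dots> \<le> norm x * norm y"
  proof (rule suminf_le_const[OF summable_cinner_norm])
    fix n
    have L2: "L2_set (\<lambda>k. cmod (coord z k)) {..<n} \<le> norm z" for z
      unfolding L2_set_def using sum_le_norm_ell2 by (intro real_le_lsqrt) (auto intro: sum_nonneg)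
    have "(\<Sum>k<n. cmod (coord x k * cnj (coord y k)))
        = (\<Sum>k<n. \<bar>cmod (coord x k)\<bar> * \<bar>cmod (coord y k)\<bar>)"
      by (simp add: norm_mult)
    also have "\<dots> \<le> L2_set (\<lambda>k. cmod (coord x k)) {..<n} * L2_set (\<lambda>k. cmod (coord y k)) {..<n}"
      by (rule L2_set_mult_ineq)
    also have "\<dots> \<le> norm x * norm y"
      by (intro mult_mono L2) auto
    finally show "(\<Sum>k<n. cmod (coord x k * cnj (coord y k))) \<le> norm x * norm y" .
  qed
  finally show ?thesis .
qed

lemma bounded_bilinear_cinner_ell2: "bounded_bilinear cinner_ell2"
proof
  fix x x' y y' :: ell2 and r :: real
  show "cinner_ell2 (x + x') y = cinner_ell2 x y + cinner_ell2 x' y"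
    by (simp add: cinner_ell2_def algebra_simps suminf_add summable_cinner)
  show "cinner_ell2 x (y + y') = cinner_ell2 x y + cinner_ell2 x y'"
    by (simp add: cinner_ell2_def algebra_simps suminf_add summable_cinner)
  show "cinner_ell2 (r *\<^sub>R x) y = r *\<^sub>R cinner_ell2 x y"
    using suminf_scaleR_right[OF summable_cinner[of x y], of r] by (simp add: cinner_ell2_def)
  show "cinner_ell2 x (r *\<^sub>R y) = r *\<^sub>R cinner_ell2 x y"
    using suminf_scaleR_right[OF summable_cinner[of x y], of r] by (simp add: cinner_ell2_def)
  show "\<exists>K. \<forall>x y. cmod (cinner_ell2 x y) \<le> norm x * norm y * K"
    by (intro exI[of _ 1]) (simp add: cmod_cinner_ell2_le)
qed

lemma bounded_bilinear_scaleC_ell2: "bounded_bilinear scaleC_ell2"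
proof
  show "\<exists>K. \<forall>c x. norm (scaleC_ell2 c x) \<le> cmod c * norm x * K"
    by (intro exI[of _ 1]) (simp add: norm_scaleC_ell2)
qed (auto intro!: ell2_eqI simp: algebra_simps)

text \<open>The rank-one operator with entries \<open>coord y j * cnj (coord z k)\<close>, see \<open>tensor_ell2_entry\<close>.
  Operators live in the library's space of bounded real-linear maps. Every operator of interest
  here is complex-linear, and for those the norm of that space is the spectral norm, because
  \<open>ell2\<close> carries the norm of the complex space.\<close>

lift_definition tensor_ell2 :: "ell2 \<Rightarrow> ell2 \<Rightarrow> (ell2 \<Rightarrow>\<^sub>L ell2)"  (infixl "\<otimes>" 75)
  is "\<lambda>y z x. scaleC_ell2 (cinner_ell2 x z) y"
  by (rule bounded_linear_compose[OF
        bounded_bilinear.bounded_linear_left[OF bounded_bilinear_scaleC_ell2]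
        bounded_bilinear.bounded_linear_left[OF bounded_bilinear_cinner_ell2]])

lift_definition unit_ell2 :: "nat \<Rightarrow> ell2" is "\<lambda>k j. if j = k then 1 else 0"
proof -
  fix k
  show "summable (\<lambda>j. (cmod (if j = k then 1 else 0))\<^sup>2)"
    by (rule summable_finite[of "{k}"]) auto
qed

lemma cinner_unit_ell2: "cinner_ell2 (unit_ell2 k) z = cnj (coord z k)"
proof -
  have "cinner_ell2 (unit_ell2 k) z = (\<Sum>j\<in>{k}. coord (unit_ell2 k) j * cnj (coord z j))"
    unfolding cinner_ell2_def by (rule suminf_finite) (auto simp: unit_ell2.rep_eq)
  then show ?thesis by (simp add: unit_ell2.rep_eq)
qed

lemma tensor_ell2_entry: "coord (blinfun_apply (y \<otimes> z) (unit_ell2 k)) j = coord y j * cnj (coord z k)"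
  by (simp add: tensor_ell2.rep_eq cinner_unit_ell2 mult.commute)

lemma norm_tensor_ell2_apply_le: "norm (blinfun_apply (y \<otimes> z) x) \<le> norm y * norm z * norm x"
proof -
  have "norm (blinfun_apply (y \<otimes> z) x) = cmod (cinner_ell2 x z) * norm y"
    by (simp add: tensor_ell2.rep_eq norm_scaleC_ell2)
  also have "\<dots> \<le> (norm x * norm z) * norm y"
    by (intro mult_right_mono cmod_cinner_ell2_le) simp
  finally show ?thesis by (simp add: mult_ac)
qed

section \<open>Expectation of a random operator\<close>

text \<open>The Bochner integral of the library needs a second-countable range, which the space of
  bounded operators does not have. The expectation of a random operator is therefore taken
  pointwise, each \<open>A \<omega> x\<close> being integrated in \<open>ell2\<close>. For \<open>A \<omega> = y \<omega> \<otimes> y \<omega>\<close> with \<open>y\<close> essentially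
  bounded this is the operator with entries \<open>expectation (\<lambda>\<omega>. coord (y \<omega>) j * cnj (coord (y \<omega>) k))\<close>: see \<open>op_expectation_tensor_entry\<close>.\<close>

definition op_expectation :: "'w measure \<Rightarrow> ('w \<Rightarrow> (ell2 \<Rightarrow>\<^sub>L ell2)) \<Rightarrow> (ell2 \<Rightarrow>\<^sub>L ell2)"
  where "op_expectation P A = Blinfun (\<lambda>x. \<integral>\<omega>. blinfun_apply (A \<omega>) x \<partial>P)"

lemma continuous_tensor_apply: "continuous_on UNIV (\<lambda>y. blinfun_apply (y \<otimes> y) x)"
  unfolding tensor_ell2.rep_eq
  by (intro bounded_bilinear.continuous_on[OF bounded_bilinear_scaleC_ell2]
      bounded_bilinear.continuous_on[OF bounded_bilinear_cinner_ell2] continuous_intros)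

lemma measurable_tensor_apply [measurable]:
  assumes [measurable]: "y \<in> borel_measurable P"
  shows "(\<lambda>\<omega>. blinfun_apply (y \<omega> \<otimes> y \<omega>) x) \<in> borel_measurable P"
  using measurable_compose[OF assms borel_measurable_continuous_onI[OF continuous_tensor_apply]]
  by simp

context prob_space
begin

lemma AE_norm_tensor_apply_le:
  assumes "AE \<omega> in M. norm (y \<omega>) \<le> K"
  shows "AE \<omega> in M. norm (blinfun_apply (y \<omega> \<otimes> y \<omega>) x) \<le> K\<^sup>2 * norm x"
  using assms
proof eventually_elim
  case (elim \<omega>)
  have "norm (y \<omega>) * norm (y \<omega>) * norm x \<le> K * K * norm x"
    using elim by (intro mult_right_mono mult_mono) (auto intro: order_trans[OF norm_ge_zero])
  then show ?case
    using norm_tensor_ell2_apply_le[of "y \<omega>" "y \<omega>" x] by (simp add: power2_eq_square)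
qed

lemma integrable_tensor_apply:
  assumes "random_variable borel y" "AE \<omega> in M. norm (y \<omega>) \<le> K"
  shows "integrable M (\<lambda>\<omega>. blinfun_apply (y \<omega> \<otimes> y \<omega>) x)"
  by (rule integrable_const_bound[OF AE_norm_tensor_apply_le[OF assms(2)]])
    (intro measurable_tensor_apply assms(1))

lemma op_expectation_tensor_apply:
  assumes "random_variable borel y" "AE \<omega> in M. norm (y \<omega>) \<le> K"
  shows "blinfun_apply (op_expectation M (\<lambda>\<omega>. y \<omega> \<otimes> y \<omega>)) x = (\<integral>\<omega>. blinfun_apply (y \<omega> \<otimes> y \<omega>) x \<partial>M)"
  unfolding op_expectation_def
proof (rule bounded_linear_Blinfun_apply[THEN fun_cong])
  note int = integrable_tensor_apply[OF assms]
  show "bounded_linear (\<lambda>x. \<integral>\<omega>. blinfun_apply (y \<omega> \<otimes> y \<omega>) x \<partial>M)"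
  proof (rule bounded_linear_intro[where K = "K\<^sup>2"])
    fix u v :: ell2 and r :: real
    show "(\<integral>\<omega>. blinfun_apply (y \<omega> \<otimes> y \<omega>) (u + v) \<partial>M)
        = (\<integral>\<omega>. blinfun_apply (y \<omega> \<otimes> y \<omega>) u \<partial>M) + (\<integral>\<omega>. blinfun_apply (y \<omega> \<otimes> y \<omega>) v \<partial>M)"
      by (simp add: blinfun.add_right int)
    show "(\<integral>\<omega>. blinfun_apply (y \<omega> \<otimes> y \<omega>) (r *\<^sub>R u) \<partial>M) = r *\<^sub>R (\<integral>\<omega>. blinfun_apply (y \<omega> \<otimes> y \<omega>) u \<partial>M)"
      by (simp add: blinfun.scaleR_right int)
    have "norm (\<integral>\<omega>. blinfun_apply (y \<omega> \<otimes> y \<omega>) u \<partial>M) \<le> (\<integral>\<omega>. norm (blinfun_apply (y \<omega> \<otimes> y \<omega>) u) \<partial>M)"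
      by (rule integral_norm_bound)
    also have "\<dots> \<le> (\<integral>\<omega>. K\<^sup>2 * norm u \<partial>M)"
      by (rule integral_mono_AE) (auto intro!: integrable_norm int AE_norm_tensor_apply_le assms)
    also have "\<dots> = norm u * K\<^sup>2" by (simp add: prob_space)
    finally show "norm (\<integral>\<omega>. blinfun_apply (y \<omega> \<otimes> y \<omega>) u \<partial>M) \<le> norm u * K\<^sup>2" .
  qed
qed

lemma op_expectation_tensor_entry:
  assumes "random_variable borel y" "AE \<omega> in M. norm (y \<omega>) \<le> K"
  shows "coord (blinfun_apply (op_expectation M (\<lambda>\<omega>. y \<omega> \<otimes> y \<omega>)) (unit_ell2 k)) j
    = expectation (\<lambda>\<omega>. coord (y \<omega>) j * cnj (coord (y \<omega>) k))"
  using integral_bounded_linear[OF bounded_linear_coord integrable_tensor_apply[OF assms],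
      of "unit_ell2 k" j]
  by (simp add: op_expectation_tensor_apply[OF assms] tensor_ell2_entry)

end

lemma norm_blinfun_measurable:
  fixes A :: "'w \<Rightarrow> (ell2 \<Rightarrow>\<^sub>L ell2)"
  assumes A: "\<And>x. (\<lambda>\<omega>. blinfun_apply (A \<omega>) x) \<in> borel_measurable P"
  shows "(\<lambda>\<omega>. norm (A \<omega>)) \<in> borel_measurable P"
proof (rule borel_measurableI_le)
  fix c :: real
  obtain D :: "ell2 set" where D: "countable D" "\<And>x e. 0 < e \<Longrightarrow> \<exists>d\<in>D. dist x d < e"
    using ell2_countable_dense by metis
  have cl: "closure D = UNIV"
    using D(2) by (fastforce simp: closure_approachable dist_commute)
  have iff: "norm T \<le> c \<longleftrightarrow> 0 \<le> c \<and> (\<forall>d\<in>D. norm (blinfun_apply T d) \<le> c * norm d)"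
    for T :: "ell2 \<Rightarrow>\<^sub>L ell2"
  proof
    assume T: "norm T \<le> c"
    then show "0 \<le> c \<and> (\<forall>d\<in>D. norm (blinfun_apply T d) \<le> c * norm d)"
      by (auto intro: order_trans[OF norm_ge_zero] order_trans[OF norm_blinfun] mult_right_mono)
  next
    assume R: "0 \<le> c \<and> (\<forall>d\<in>D. norm (blinfun_apply T d) \<le> c * norm d)"
    have "closed {x. norm (blinfun_apply T x) \<le> c * norm x}"
      by (intro closed_Collect_le continuous_intros)
    moreover have "D \<subseteq> {x. norm (blinfun_apply T x) \<le> c * norm x}" using R by auto
    ultimately have "UNIV \<subseteq> {x. norm (blinfun_apply T x) \<le> c * norm x}"
      unfolding cl[symmetric] by (rule closure_minimal[rotated])
    with R show "norm T \<le> c" by (intro norm_blinfun_bound) auto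
  qed
  have "{\<omega> \<in> space P. norm (A \<omega>) \<le> c}
      = {\<omega> \<in> space P. 0 \<le> c \<and> (\<forall>d\<in>D. norm (blinfun_apply (A \<omega>) d) \<le> c * norm d)}"
    by (simp add: iff)
  also have "\<dots> \<in> sets P"
  proof -
    have [measurable]: "Measurable.pred P (\<lambda>\<omega>. norm (blinfun_apply (A \<omega>) d) \<le> c * norm d)" for d
      using A[of d] by measurable
    have ne: "D \<noteq> {}" using D(2)[of 1 0] by auto
    have "(\<Inter>d\<in>D. {\<omega> \<in> space P. norm (blinfun_apply (A \<omega>) d) \<le> c * norm d}) \<in> sets P"
      by (intro sets.countable_INT' D(1) ne) auto
    also have "(\<Inter>d\<in>D. {\<omega> \<in> space P. norm (blinfun_apply (A \<omega>) d) \<le> c * norm d})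
        = {\<omega> \<in> space P. \<forall>d\<in>D. norm (blinfun_apply (A \<omega>) d) \<le> c * norm d}"
      using ne by auto
    finally show ?thesis
      by (intro sets.sets_Collect_conj sets.sets_Collect_const)
  qed
  finally show "{\<omega> \<in> space P. norm (A \<omega>) \<le> c} \<in> sets P" .
qed

lemma deviation_event_measurable:
  assumes "\<And>i. i \<in> I \<Longrightarrow> y i \<in> borel_measurable P"
  shows "{\<omega> \<in> space P. norm (c *\<^sub>R (\<Sum>i\<in>I. y i \<omega> \<otimes> y i \<omega>) - \<Lambda>) \<ge> t} \<in> sets P"
proof -
  have "(\<lambda>\<omega>. norm (c *\<^sub>R (\<Sum>i\<in>I. y i \<omega> \<otimes> y i \<omega>) - \<Lambda>)) \<in> borel_measurable P"
  proof (rule norm_blinfun_measurable)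
    fix x
    show "(\<lambda>\<omega>. blinfun_apply (c *\<^sub>R (\<Sum>i\<in>I. y i \<omega> \<otimes> y i \<omega>) - \<Lambda>) x) \<in> borel_measurable P"
      unfolding blinfun.diff_left blinfun.scaleR_left blinfun.sum_left
      by (intro borel_measurable_diff borel_measurable_scaleR borel_measurable_sum
          borel_measurable_const measurable_tensor_apply assms)
  qed
  then show ?thesis by measurable
qed

end

theory Submission
  imports Defs
begin

text \<open>
  Let \<open>S\<close> be a random sum of the \<open>y\<^sup>i \<otimes> y\<^sup>i\<close> with independent signs, and \<open>Z\<close> the sum without
  signs. Flipping the sign of one summand in \<open>E tr S\<^sup>2\<^sup>p = \<Sum>\<^sub>i E \<epsilon>\<^sub>i \<langle>S\<^sup>2\<^sup>p\<^sup>-\<^sup>1 y\<^sup>i, y\<^sup>i\<rangle>\<close> and using that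
  \<open>\<parallel>S\<^sup>j y\<parallel>\<close> is log-convex in \<open>j\<close> gives \<open>E tr S\<^sup>2\<^sup>p \<le> (2p - 1) M\<^sup>2 \<parallel>Z\<parallel> E tr S\<^sup>2\<^sup>p\<^sup>-\<^sup>2\<close>, hence the
  subgaussian bound \<open>E exp (\<theta> \<parallel>S\<parallel>) \<le> 2 n exp (\<theta>\<^sup>2 M\<^sup>2 \<parallel>Z\<parallel> / 2)\<close>; the factor is \<open>n\<close> and not the
  dimension because the \<open>y\<^sup>i\<close> span the range of \<open>S\<close>.

  With \<open>D = \<parallel>Z - n \<Lambda>\<parallel>\<close> and \<open>F = E exp (s D)\<close>, symmetrization by a ghost sample and
  \<open>\<parallel>Z\<parallel> \<le> n + D\<close> turn this into the self-bounding inequality \<open>F \<le> 2 n exp (a s n) F\<^sup>a\<close> with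
  \<open>a = 2 s M\<^sup>2\<close>. For \<open>s = t / (8 M\<^sup>2)\<close> Markov's inequality yields the tail
  \<open>(2 n)\<^sup>4\<^sup>/\<^sup>3 exp (- t\<^sup>2 n / (12 M\<^sup>2))\<close>, which is below the claimed bound whenever the latter is
  less than \<open>1\<close>.
\<close>

section \<open>Convex and log-convex sequences\<close>

text \<open>The increments are nondecreasing, so the first \<open>q\<close> of them add up to at
  most the last \<open>q\<close>.\<close>

lemma convex_seq_endpoint_bound:
  fixes f :: "nat \<Rightarrow> real"
  assumes cvx: "\<And>q. q + 2 \<le> m \<Longrightarrow> 2 * f (q + 1) \<le> f q + f (q + 2)" and "q \<le> m"
  shows "f q + f (m - q) \<le> f 0 + f m"
proof -
  define g where "g j = f (Suc j) - f j" for j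
  have step: "g j \<le> g (j + k)" if "j + k < m" for j k
    using that
  proof (induction k)
    case (Suc k)
    then have "g j \<le> g (j + k)" by simp
    also have "\<dots> \<le> g (j + Suc k)"
      using cvx[of "j + k"] Suc.prems by (simp add: g_def)
    finally show ?case .
  qed simp
  have "f q - f 0 = (\<Sum>j<q. g j)"
    unfolding g_def by (rule sum_lessThan_telescope[symmetric])
  also have "\<dots> \<le> (\<Sum>j<q. g ((m - q) + j))"
  proof (rule sum_mono)
    fix j assume "j \<in> {..<q}"
    then have "g j \<le> g (j + (m - q))" using \<open>q \<le> m\<close> by (intro step) auto
    then show "g j \<le> g ((m - q) + j)" by (simp add: add.commute)
  qed
  also have "\<dots> = f m - f (m - q)"
    using sum_lessThan_telescope[of "\<lambda>j. f ((m - q) + j)" q] \<open>q \<le> m\<close> by (simp add: g_def)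
  finally show ?thesis by linarith
qed

text \<open>The product \<open>d q * e (m - q)\<close> is log-convex in \<open>q\<close>, hence
  convex by the inequality of arithmetic and geometric means; each pair \<open>q\<close>,
  \<open>m - q\<close> is then bounded by the endpoints. Log-convexity is stated without logarithms
  because terms may vanish.\<close>

lemma log_convex_convolution_le:
  fixes d e :: "nat \<Rightarrow> real"
  assumes nonneg: "\<And>q. 0 \<le> d q" "\<And>q. 0 \<le> e q"
    and d: "\<And>q. (d (q + 1))\<^sup>2 \<le> d q * d (q + 2)"
    and e: "\<And>q. (e (q + 1))\<^sup>2 \<le> e q * e (q + 2)"
  shows "2 * (\<Sum>q\<le>m. d q * e (m - q)) \<le> real (m + 1) * (d 0 * e m + d m * e 0)"
proof -
  define f where "f q = d q * e (m - q)" for q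
  have cvx: "2 * f (q + 1) \<le> f q + f (q + 2)" if "q + 2 \<le> m" for q
  proof -
    obtain r where m: "m = q + 2 + r" using le_Suc_ex[OF \<open>q + 2 \<le> m\<close>] by blast
    have f0: "0 \<le> f q" for q by (simp add: f_def nonneg)
    have idx: "m - (q + 1) = r + 1" "m - q = r + 2" "m - (q + 2) = r" using m by simp_all
    have "(f (q + 1))\<^sup>2 = (d (q + 1))\<^sup>2 * (e (r + 1))\<^sup>2"
      unfolding f_def idx by (rule power_mult_distrib)
    also have "\<dots> \<le> (d q * d (q + 2)) * (e r * e (r + 2))"
      by (intro mult_mono d e) (auto intro: nonneg mult_nonneg_nonneg)
    also have "\<dots> = f q * f (q + 2)"
      unfolding f_def idx by (simp only: mult_ac)
    finally have "(f (q + 1))\<^sup>2 \<le> f q * f (q + 2)" .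
    moreover have "4 * (f q * f (q + 2)) \<le> (f q + f (q + 2))\<^sup>2"
      using sum_squares_bound[of "f q" "f (q + 2)"] by (simp add: power2_sum)
    ultimately have "(2 * f (q + 1))\<^sup>2 \<le> (f q + f (q + 2))\<^sup>2"
      by (simp add: power_mult_distrib)
    then show ?thesis
      by (rule power2_le_imp_le) (simp add: f0)
  qed
  have "2 * (\<Sum>q\<le>m. f q) = (\<Sum>q\<le>m. f q) + (\<Sum>q\<le>m. f (m - q))"
    using sum.nat_diff_reindex[of f "Suc m"] by (simp add: lessThan_Suc_atMost)
  also have "\<dots> = (\<Sum>q\<le>m. f q + f (m - q))" by (simp add: sum.distrib)
  also have "\<dots> \<le> (\<Sum>q\<le>m. f 0 + f m)"
    by (intro sum_mono convex_seq_endpoint_bound cvx) auto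
  finally show ?thesis by (simp add: f_def)
qed

section \<open>Powers of hermitian operators\<close>

lemma cinner_ell2_commute: "cinner_ell2 y x = cnj (cinner_ell2 x y)"
  unfolding cinner_ell2_def
  by (subst bounded_linear.suminf[OF bounded_linear_cnj summable_cinner]) (simp add: mult.commute)

lemma Re_cinner_ell2: "Re (cinner_ell2 x y) = inner x y"
  unfolding cinner_ell2_def inner_ell2_def
  by (subst bounded_linear.suminf[OF bounded_linear_Re summable_cinner])
    (simp add: inner_complex_def)

lemma cinner_ell2_self: "cinner_ell2 x x = of_real ((norm x)\<^sup>2)"
  by (rule complex_eqI)
    (use cinner_ell2_commute[of x x] in \<open>auto simp: Re_cinner_ell2 dot_square_norm complex_eq_iff\<close>)

lemma cinner_scaleC_left: "cinner_ell2 (scaleC_ell2 c x) y = c * cinner_ell2 x y"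
  by (simp add: cinner_ell2_def suminf_mult summable_cinner mult.assoc)

lemma cinner_scaleC_right: "cinner_ell2 x (scaleC_ell2 c y) = cnj c * cinner_ell2 x y"
  by (metis cinner_ell2_commute cinner_scaleC_left complex_cnj_mult)

lemmas cinner_ell2_simps =
  bounded_bilinear.add_left[OF bounded_bilinear_cinner_ell2]
  bounded_bilinear.add_right[OF bounded_bilinear_cinner_ell2]
  bounded_bilinear.scaleR_left[OF bounded_bilinear_cinner_ell2]
  bounded_bilinear.scaleR_right[OF bounded_bilinear_cinner_ell2]
  bounded_bilinear.sum_left[OF bounded_bilinear_cinner_ell2]
  bounded_bilinear.sum_right[OF bounded_bilinear_cinner_ell2]

text \<open>Symmetry for the complex inner product also forces complex linearity, which a bounded
  real-linear map need not have.\<close>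

definition hermitian_op :: "(ell2 \<Rightarrow>\<^sub>L ell2) \<Rightarrow> bool"
  where "hermitian_op T \<longleftrightarrow> (\<forall>x z. cinner_ell2 (blinfun_apply T x) z = cinner_ell2 x (blinfun_apply T z))"

lemma hermitian_tensor: "hermitian_op (y \<otimes> y)"
  unfolding hermitian_op_def tensor_ell2.rep_eq cinner_scaleC_left cinner_scaleC_right
  by (simp add: cinner_ell2_commute[symmetric] mult.commute)

lemma hermitian_sum_scaleR:
  "(\<And>i. i \<in> I \<Longrightarrow> hermitian_op (H i)) \<Longrightarrow> hermitian_op (\<Sum>i\<in>I. r i *\<^sub>R H i)"
  unfolding hermitian_op_def blinfun.sum_left blinfun.scaleR_left cinner_ell2_simps
  by (intro allI sum.cong) auto

abbreviation op_pow :: "(ell2 \<Rightarrow>\<^sub>L ell2) \<Rightarrow> nat \<Rightarrow> ell2 \<Rightarrow> ell2"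
  where "op_pow T k \<equiv> blinfun_apply T ^^ k"

lemma hermitian_op_pow:
  assumes "hermitian_op T"
  shows "cinner_ell2 (op_pow T k x) z = cinner_ell2 x (op_pow T k z)"
proof (induction k arbitrary: x z)
  case (Suc k)
  then show ?case using assms by (simp add: hermitian_op_def funpow_swap1)
qed simp

lemma hermitian_op_pow_inner:
  assumes "hermitian_op T"
  shows "inner (op_pow T (j + k) x) z = inner (op_pow T j x) (op_pow T k z)"
  using hermitian_op_pow[OF assms, of k "op_pow T j x" z]
  by (metis Re_cinner_ell2 add.commute comp_apply funpow_add)

text \<open>Ensures that a rank-one perturbation produces real scalars, which act through
  \<open>scaleR\<close>.\<close>

lemma cinner_op_pow_self_real:
  assumes "hermitian_op T"
  shows "cinner_ell2 (op_pow T k x) x = of_real (inner (op_pow T k x) x)"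
proof -
  have "cnj (cinner_ell2 (op_pow T k x) x) = cinner_ell2 (op_pow T k x) x"
    by (metis cinner_ell2_commute hermitian_op_pow[OF assms])
  then show ?thesis
    by (metis Re_cinner_ell2 Reals_cnj_iff of_real_Re)
qed

text \<open>Move one factor \<open>T\<close> across the inner product and apply
  Cauchy-Schwarz.\<close>

lemma norm_op_pow_log_convex:
  assumes "hermitian_op T"
  shows "(norm (op_pow T (j + 1) x))\<^sup>2 \<le> norm (op_pow T j x) * norm (op_pow T (j + 2) x)"
proof -
  have "(norm (op_pow T (j + 1) x))\<^sup>2 = inner (op_pow T (j + 1) x) (op_pow T (j + 1) x)"
    by (simp add: dot_square_norm)
  also have "\<dots> = inner (op_pow T (j + 2) x) (op_pow T j x)"
    using hermitian_op_pow_inner[OF assms, of "j + 1" "j + 1" x x]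
      hermitian_op_pow_inner[OF assms, of "j + 2" j x x] by (simp add: ac_simps del: funpow.simps)
  also have "\<dots> \<le> norm (op_pow T (j + 2) x) * norm (op_pow T j x)"
    by (rule norm_cauchy_schwarz)
  finally show ?thesis by (simp add: mult.commute)
qed

text \<open>Log-convexity makes the ratios of consecutive norms nondecreasing, so the product of the
  first \<open>Suc k\<close> ratios is at least that power of the first one. This takes the place of
  the spectral theorem when \<open>T\<close> is compared with its powers.\<close>

lemma norm_op_pow_ge:
  assumes "hermitian_op T"
  shows "norm (blinfun_apply T x) ^ Suc k \<le> norm (op_pow T (Suc k) x) * norm x ^ k"
proof -
  define b where "b j = norm (op_pow T j x)" for j
  have b0: "0 \<le> b j" for j by (simp add: b_def)
  have lc: "(b (j + 1))\<^sup>2 \<le> b j * b (j + 2)" for j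
    unfolding b_def by (rule norm_op_pow_log_convex[OF assms])
  \<comment> \<open>The first ratio is at most every later one, cleared of denominators since norms
    may vanish.\<close>
  have ratio: "b (j + 1) * b 1 \<le> b (j + 2) * b 0" for j
  proof (induction j)
    case 0
    then show ?case using lc[of 0] by (simp add: power2_eq_square mult.commute)
  next
    case (Suc j)
    show ?case
    proof (cases "b (j + 1) = 0")
      case True
      then have "(b (j + 2))\<^sup>2 \<le> 0" using lc[of "j + 1"] by simp
      then have "b (j + 2) = 0" by simp
      then show ?thesis using b0 by simp
    next
      case False
      then have pos: "0 < b (j + 1)" using b0[of "j + 1"] by linarith
      have "b (j + 1) * (b (j + 2) * b 1) = b (j + 2) * (b (j + 1) * b 1)" by (simp add: mult_ac)
      also have "\<dots> \<le> b (j + 2) * (b (j + 2) * b 0)"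
        by (intro mult_left_mono Suc b0)
      also have "\<dots> = (b (j + 1 + 1))\<^sup>2 * b 0" by (simp add: power2_eq_square)
      also have "\<dots> \<le> (b (j + 1) * b (j + 1 + 2)) * b 0"
        by (intro mult_right_mono lc b0)
      finally have "b (j + 1) * (b (j + 2) * b 1) \<le> b (j + 1) * (b (j + 3) * b 0)"
        by (simp add: mult_ac numeral_3_eq_3)
      then show ?thesis using pos by (simp add: numeral_3_eq_3)
    qed
  qed
  have "b 1 ^ Suc k \<le> b (Suc k) * b 0 ^ k"
  proof (induction k)
    case (Suc k)
    have "b 1 ^ Suc (Suc k) = b 1 ^ Suc k * b 1" by simp
    also have "\<dots> \<le> (b (Suc k) * b 0 ^ k) * b 1" by (intro mult_right_mono Suc b0)
    also have "\<dots> = (b (k + 1) * b 1) * b 0 ^ k" by (simp add: mult_ac)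
    also have "\<dots> \<le> (b (k + 2) * b 0) * b 0 ^ k" by (intro mult_right_mono ratio zero_le_power b0)
    finally show ?case by (simp add: mult_ac)
  qed simp
  then show ?thesis by (simp add: b_def)
qed

text \<open>A log-convex majorant of the moment sequence \<open>\<langle>T\<^sup>q x, x\<rangle>\<close>, whose odd terms need not be
  nonnegative; at even \<open>q\<close> it is exact.\<close>

definition moment_majorant :: "(ell2 \<Rightarrow>\<^sub>L ell2) \<Rightarrow> ell2 \<Rightarrow> nat \<Rightarrow> real"
  where "moment_majorant T x q = norm (op_pow T (q div 2) x) * norm (op_pow T ((q + 1) div 2) x)"

lemma moment_majorant_nonneg: "0 \<le> moment_majorant T x q"
  by (simp add: moment_majorant_def)

text \<open>Distribute the \<open>q\<close> factors as evenly as possible over both arguments, then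
  use Cauchy-Schwarz.\<close>

lemma abs_moment_le_majorant:
  assumes "hermitian_op T"
  shows "\<bar>inner (op_pow T q x) x\<bar> \<le> moment_majorant T x q"
proof -
  have "q div 2 + (q + 1) div 2 = q" by presburger
  then have "inner (op_pow T q x) x = inner (op_pow T (q div 2) x) (op_pow T ((q + 1) div 2) x)"
    using hermitian_op_pow_inner[OF assms, of "q div 2" "(q + 1) div 2" x x] by simp
  then show ?thesis
    unfolding moment_majorant_def by (simp add: Cauchy_Schwarz_ineq2)
qed

lemma moment_majorant_even:
  assumes "hermitian_op T"
  shows "moment_majorant T x (2 * k) = inner (op_pow T (2 * k) x) x"
  using hermitian_op_pow_inner[OF assms, of k k x x]
  by (simp add: moment_majorant_def mult_2 dot_square_norm power2_eq_square)

text \<open>For even \<open>q\<close> both sides coincide; for \<open>q = 2 * j + 1\<close> the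
  claim is the log-convexity of the norms at \<open>j\<close>, multiplied by the square of the norm
  at \<open>j + 1\<close>.\<close>

lemma moment_majorant_log_convex:
  assumes "hermitian_op T"
  shows "(moment_majorant T x (q + 1))\<^sup>2 \<le> moment_majorant T x q * moment_majorant T x (q + 2)"
proof -
  define b where "b j = norm (op_pow T j x)" for j
  have m: "moment_majorant T x q = b (q div 2) * b ((q + 1) div 2)" for q
    by (simp add: moment_majorant_def b_def)
  show ?thesis
  proof (cases "even q")
    case True
    then obtain j where "q = 2 * j" by blast
    then show ?thesis by (simp add: m power2_eq_square)
  next
    case False
    then obtain j where q: "q = 2 * j + 1" by (blast elim: oddE)
    have "(b (j + 1))\<^sup>2 * (b (j + 1))\<^sup>2 \<le> (b (j + 1))\<^sup>2 * (b j * b (j + 2))"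
      unfolding b_def by (intro mult_left_mono norm_op_pow_log_convex assms) auto
    moreover have "(2 * j + 1 + 1) div 2 = j + 1" "(2 * j + 1 + 1 + 1) div 2 = j + 1"
      "(2 * j + 1) div 2 = j" "(2 * j + 1 + 2) div 2 = j + 1" "(2 * j + 1 + 2 + 1) div 2 = j + 2"
      by presburger+
    ultimately show ?thesis
      unfolding q m by (simp add: power2_eq_square mult_ac)
  qed
qed

text \<open>The majorants bring the odd moments, of either sign, into the log-convex estimate; as
  \<open>m\<close> is even, the endpoint terms are genuine moments again.\<close>

lemma moment_convolution_le:
  assumes "hermitian_op S" "hermitian_op T" "even m"
  shows "2 * (\<Sum>q\<le>m. inner (op_pow S q x) x * inner (op_pow T (m - q) x) x)
    \<le> real (m + 1) * (norm x)\<^sup>2 * (inner (op_pow S m x) x + inner (op_pow T m x) x)"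
proof -
  obtain k where m: "m = 2 * k" using \<open>even m\<close> by blast
  have "2 * (\<Sum>q\<le>m. inner (op_pow S q x) x * inner (op_pow T (m - q) x) x)
      \<le> 2 * (\<Sum>q\<le>m. moment_majorant S x q * moment_majorant T x (m - q))"
  proof (intro mult_left_mono sum_mono)
    fix q
    have "inner (op_pow S q x) x * inner (op_pow T (m - q) x) x
        \<le> \<bar>inner (op_pow S q x) x\<bar> * \<bar>inner (op_pow T (m - q) x) x\<bar>"
      by (metis abs_ge_self abs_mult)
    also have "\<dots> \<le> moment_majorant S x q * moment_majorant T x (m - q)"
      by (intro mult_mono abs_moment_le_majorant assms moment_majorant_nonneg) auto
    finally show "inner (op_pow S q x) x * inner (op_pow T (m - q) x) x
        \<le> moment_majorant S x q * moment_majorant T x (m - q)" .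
  qed simp
  also have "\<dots> \<le> real (m + 1) * (moment_majorant S x 0 * moment_majorant T x m
      + moment_majorant S x m * moment_majorant T x 0)"
    by (intro log_convex_convolution_le moment_majorant_nonneg moment_majorant_log_convex assms)
  also have "\<dots> = real (m + 1) * (norm x)\<^sup>2 * (inner (op_pow S m x) x + inner (op_pow T m x) x)"
    unfolding m moment_majorant_even[OF assms(1)] moment_majorant_even[OF assms(2)]
    by (simp add: moment_majorant_def power2_eq_square algebra_simps)
  finally show ?thesis .
qed

section \<open>Operator norm versus traces of powers\<close>

lemma scaleC_of_real: "scaleC_ell2 (of_real r) x = r *\<^sub>R x"
  by (rule ell2_eqI) (simp add: scaleR_conv_of_real)

lemma norm_sq_sums: "(\<lambda>j. (cmod (coord x j))\<^sup>2) sums (norm x)\<^sup>2"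
  unfolding norm_ell2_sq by (rule summable_sums[OF summable_coord])

lemma cinner_sums: "(\<lambda>j. coord x j * cnj (coord z j)) sums cinner_ell2 x z"
  unfolding cinner_ell2_def by (rule summable_sums[OF summable_cinner])

lemma cinner_unit_right: "cinner_ell2 z (unit_ell2 j) = coord z j"
  by (metis cinner_ell2_commute cinner_unit_ell2 complex_cnj_cnj)

lemma coord_op_pow:
  "hermitian_op T \<Longrightarrow> coord (op_pow T k x) j = cinner_ell2 x (op_pow T k (unit_ell2 j))"
  by (metis cinner_unit_right hermitian_op_pow)

text \<open>\<open>\<tau>\<close> is the squared Hilbert-Schmidt norm of the \<open>k\<close>-th
  power; Cauchy-Schwarz in each coordinate bounds the operator norm by it.\<close>

lemma norm_op_pow_le_trace:
  assumes "hermitian_op T" and \<tau>: "(\<lambda>j. (norm (op_pow T k (unit_ell2 j)))\<^sup>2) sums \<tau>"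
  shows "(norm (op_pow T k x))\<^sup>2 \<le> (norm x)\<^sup>2 * \<tau>"
proof (rule sums_le[OF _ norm_sq_sums sums_mult[OF \<tau>]])
  fix j
  show "(cmod (coord (op_pow T k x) j))\<^sup>2 \<le> (norm x)\<^sup>2 * (norm (op_pow T k (unit_ell2 j)))\<^sup>2"
    unfolding coord_op_pow[OF assms(1)] power_mult_distrib[symmetric]
    by (intro power_mono cmod_cinner_ell2_le) simp
qed

text \<open>The trace controls the power \<open>Suc k\<close> of \<open>T\<close>, and
  \<open>norm_op_pow_ge\<close> carries this back to \<open>T\<close> without eigenvalues.\<close>

lemma norm_power_le_trace:
  assumes "hermitian_op T" and \<tau>: "(\<lambda>j. (norm (op_pow T (Suc k) (unit_ell2 j)))\<^sup>2) sums \<tau>"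
  shows "norm T ^ (2 * Suc k) \<le> \<tau>"
proof -
  have "0 \<le> \<tau>" by (rule sums_le[OF _ sums_zero \<tau>]) simp
  define r where "r = root (Suc k) (sqrt \<tau>)"
  have r0: "0 \<le> r" using \<open>0 \<le> \<tau>\<close> by (simp add: r_def)
  have r: "r ^ Suc k = sqrt \<tau>" unfolding r_def using \<open>0 \<le> \<tau>\<close> by (intro real_root_pow_pos2) auto
  have "norm (blinfun_apply T x) \<le> r * norm x" for x
  proof (rule power_le_imp_le_base)
    have "norm (op_pow T (Suc k) x) \<le> norm x * sqrt \<tau>"
      using real_sqrt_le_mono[OF norm_op_pow_le_trace[OF assms, of x]] by (simp add: real_sqrt_mult)
    then have "norm (op_pow T (Suc k) x) * norm x ^ k \<le> (norm x * sqrt \<tau>) * norm x ^ k"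
      by (rule mult_right_mono) simp
    then have "norm (blinfun_apply T x) ^ Suc k \<le> (norm x * sqrt \<tau>) * norm x ^ k"
      using norm_op_pow_ge[OF assms(1), of x k] by linarith
    also have "\<dots> = (r * norm x) ^ Suc k"
      unfolding power_mult_distrib r by simp
    finally show "norm (blinfun_apply T x) ^ Suc k \<le> (r * norm x) ^ Suc k" .
  qed (use r0 in simp)
  then have "norm T \<le> r" by (intro norm_blinfun_bound r0)
  then have "norm T ^ (2 * Suc k) \<le> r ^ (2 * Suc k)" by (rule power_mono) simp
  also have "\<dots> = (r ^ Suc k)\<^sup>2" by (simp only: power_mult[symmetric] mult.commute)
  also have "\<dots> = \<tau>" unfolding r using \<open>0 \<le> \<tau>\<close> by simp
  finally show ?thesis .
qed

section \<open>Rademacher sums of rank-one operators\<close>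

definition sgn_in :: "'i set \<Rightarrow> 'i \<Rightarrow> real"
  where "sgn_in A i = (if i \<in> A then 1 else - 1)"

text \<open>Sign patterns on \<open>I\<close> are encoded by the set \<open>A \<subseteq> I\<close> of positive indices.\<close>

definition signed_op :: "'i set \<Rightarrow> ('i \<Rightarrow> ell2) \<Rightarrow> 'i set \<Rightarrow> (ell2 \<Rightarrow>\<^sub>L ell2)"
  where "signed_op I y A = (\<Sum>i\<in>I. sgn_in A i *\<^sub>R (y i \<otimes> y i))"

text \<open>The trace of the \<open>(k + 1)\<close>-st power of \<open>signed_op I y A\<close>, expressed through the vectors
  spanning its range.\<close>

definition signed_trace :: "'i set \<Rightarrow> ('i \<Rightarrow> ell2) \<Rightarrow> 'i set \<Rightarrow> nat \<Rightarrow> real"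
  where "signed_trace I y A k = (\<Sum>i\<in>I. sgn_in A i * inner (op_pow (signed_op I y A) k (y i)) (y i))"

text \<open>The sum \<open>Z\<close> of the overview. It is \<open>Y Y*\<close> for the operator
  \<open>Y\<close> with columns \<open>y i\<close>, so for finite \<open>I\<close> its norm is that
  of the Gram matrix.\<close>

definition gram_op :: "'i set \<Rightarrow> ('i \<Rightarrow> ell2) \<Rightarrow> (ell2 \<Rightarrow>\<^sub>L ell2)"
  where "gram_op I y = (\<Sum>i\<in>I. y i \<otimes> y i)"

lemma hermitian_signed_op: "hermitian_op (signed_op I y A)"
  unfolding signed_op_def by (intro hermitian_sum_scaleR hermitian_tensor)

lemma inner_tensor: "inner (blinfun_apply (y \<otimes> y) v) z = Re (cinner_ell2 v y * cinner_ell2 y z)"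
  by (simp add: Re_cinner_ell2[symmetric] tensor_ell2.rep_eq cinner_scaleC_left)

text \<open>Both sides are the trace of the power \<open>2 * k + 2\<close>. Expanding the outermost
  factor into rank-one terms and summing over the unit vectors first turns products of coordinates
  into inner products.\<close>

lemma signed_trace_sums:
  "(\<lambda>j. (norm (op_pow (signed_op I y A) (Suc k) (unit_ell2 j)))\<^sup>2) sums signed_trace I y A (2 * k + 1)"
proof -
  let ?S = "signed_op I y A"
  note herm = hermitian_signed_op[of I y A]
  define m where "m = 2 * k + 1"
  have "(norm (op_pow ?S (Suc k) e))\<^sup>2
      = (\<Sum>i\<in>I. sgn_in A i * Re (cinner_ell2 (y i) e * cnj (cinner_ell2 (op_pow ?S m (y i)) e)))" for e
  proof -
    have "(norm (op_pow ?S (Suc k) e))\<^sup>2 = inner (op_pow ?S (Suc k + Suc k) e) e"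
      unfolding hermitian_op_pow_inner[OF herm] by (simp only: dot_square_norm)
    also have "Suc k + Suc k = Suc m" by (simp add: m_def)
    also have "inner (op_pow ?S (Suc m) e) e = inner (blinfun_apply ?S (op_pow ?S m e)) e"
      by simp
    also have "\<dots> = (\<Sum>i\<in>I. sgn_in A i * Re (cinner_ell2 (op_pow ?S m e) (y i) * cinner_ell2 (y i) e))"
      by (subst (1) signed_op_def)
        (simp add: blinfun.sum_left blinfun.scaleR_left inner_sum_left inner_tensor)
    also have "\<dots> = (\<Sum>i\<in>I. sgn_in A i * Re (cinner_ell2 (y i) e * cnj (cinner_ell2 (op_pow ?S m (y i)) e)))"
      by (simp only: hermitian_op_pow[OF herm] cinner_ell2_commute[symmetric] mult.commute)
    finally show ?thesis .
  qed
  then have eq: "(norm (op_pow ?S (Suc k) (unit_ell2 j)))\<^sup>2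
      = (\<Sum>i\<in>I. sgn_in A i * Re (coord (y i) j * cnj (coord (op_pow ?S m (y i)) j)))" for j
    by (simp only: cinner_unit_right)
  have "(\<lambda>j. \<Sum>i\<in>I. sgn_in A i * Re (coord (y i) j * cnj (coord (op_pow ?S m (y i)) j)))
      sums (\<Sum>i\<in>I. sgn_in A i * Re (cinner_ell2 (y i) (op_pow ?S m (y i))))"
    by (intro sums_sum sums_mult sums_Re cinner_sums)
  then show ?thesis
    unfolding eq signed_trace_def m_def[symmetric] Re_cinner_ell2 by (simp only: inner_commute)
qed

lemma inner_gram_op: "inner (blinfun_apply (gram_op I y) v) v = (\<Sum>i\<in>I. (cmod (cinner_ell2 (y i) v))\<^sup>2)"
proof -
  have "Re (cinner_ell2 v (y i) * cinner_ell2 (y i) v) = (cmod (cinner_ell2 (y i) v))\<^sup>2" for i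
    by (subst cinner_ell2_commute[of v "y i"]) (simp add: cmod_def power2_eq_square)
  then show ?thesis
    by (simp add: gram_op_def blinfun.sum_left inner_sum_left inner_tensor)
qed

lemma gram_op_form_le: "(\<Sum>i\<in>I. (cmod (cinner_ell2 (y i) v))\<^sup>2) \<le> norm (gram_op I y) * (norm v)\<^sup>2"
proof -
  have "inner (blinfun_apply (gram_op I y) v) v \<le> norm (blinfun_apply (gram_op I y) v) * norm v"
    by (rule norm_cauchy_schwarz)
  also have "\<dots> \<le> (norm (gram_op I y) * norm v) * norm v"
    by (intro mult_right_mono norm_blinfun) simp
  finally show ?thesis by (simp add: inner_gram_op power2_eq_square mult.assoc)
qed

text \<open>For fixed \<open>j\<close>, the coordinates of the vectors
  \<open>op_pow T k (y i)\<close> make up the quadratic form of \<open>gram_op I y\<close> at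
  \<open>op_pow T k (unit_ell2 j)\<close>. This is where the norm of \<open>Z\<close> enters instead
  of a sum of squared norms.\<close>

lemma sum_norm_op_pow_le_trace:
  assumes "hermitian_op T" and \<tau>: "(\<lambda>j. (norm (op_pow T k (unit_ell2 j)))\<^sup>2) sums \<tau>"
  shows "(\<Sum>i\<in>I. (norm (op_pow T k (y i)))\<^sup>2) \<le> norm (gram_op I y) * \<tau>"
proof (rule sums_le[OF _ sums_sum[OF norm_sq_sums] sums_mult[OF \<tau>]])
  fix j
  show "(\<Sum>i\<in>I. (cmod (coord (op_pow T k (y i)) j))\<^sup>2)
      \<le> norm (gram_op I y) * (norm (op_pow T k (unit_ell2 j)))\<^sup>2"
    unfolding coord_op_pow[OF assms(1)] by (rule gram_op_form_le)
qed

text \<open>Evaluate the quadratic form at \<open>y i\<close> itself and keep only the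
  \<open>i\<close>-th term.\<close>

lemma norm_sq_le_gram_op:
  assumes "finite I" "i \<in> I"
  shows "(norm (y i))\<^sup>2 \<le> norm (gram_op I y)"
proof (cases "y i = 0")
  case False
  have "(norm (y i))\<^sup>2 * (norm (y i))\<^sup>2 = (cmod (cinner_ell2 (y i) (y i)))\<^sup>2"
    by (simp add: cinner_ell2_self norm_mult power2_eq_square)
  also have "\<dots> \<le> (\<Sum>j\<in>I. (cmod (cinner_ell2 (y j) (y i)))\<^sup>2)"
    by (rule member_le_sum[OF assms(2) _ assms(1)]) simp
  also have "\<dots> \<le> norm (gram_op I y) * (norm (y i))\<^sup>2"
    by (rule gram_op_form_le)
  finally show ?thesis using False by (simp only: mult_le_cancel_right) simp
qed simp

section \<open>Flipping one sign\<close>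

text \<open>Telescoping writes the difference as the sum of \<open>S^q (S - T) T^(m - q)\<close>;
  applied to \<open>y\<close>, the rank-one factor returns a real multiple of
  \<open>y\<close>.\<close>

lemma op_pow_diff_rank_one:
  assumes T: "hermitian_op T" and ST: "S - T = c *\<^sub>R (y \<otimes> y)"
  shows "op_pow S (Suc m) y - op_pow T (Suc m) y
    = (\<Sum>q\<le>m. (c * inner (op_pow T (m - q) y) y) *\<^sub>R op_pow S q y)"
proof -
  have rank_one: "blinfun_apply S (op_pow T k y) - blinfun_apply T (op_pow T k y)
      = (c * inner (op_pow T k y) y) *\<^sub>R y" for k
    unfolding blinfun.diff_left[symmetric] ST blinfun.scaleR_left tensor_ell2.rep_eq
      cinner_op_pow_self_real[OF T] scaleC_of_real by simp
  show ?thesis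
  proof (induction m)
    case 0
    then show ?case using rank_one[of 0] by simp
  next
    case (Suc m)
    have "op_pow S (Suc (Suc m)) y - op_pow T (Suc (Suc m)) y
        = (blinfun_apply S (op_pow T (Suc m) y) - blinfun_apply T (op_pow T (Suc m) y))
          + blinfun_apply S (op_pow S (Suc m) y - op_pow T (Suc m) y)"
      by (simp add: blinfun.diff_right)
    also have "\<dots> = (c * inner (op_pow T (Suc m) y) y) *\<^sub>R y
        + (\<Sum>q\<le>m. (c * inner (op_pow T (m - q) y) y) *\<^sub>R op_pow S (Suc q) y)"
      unfolding rank_one Suc by (simp add: blinfun.sum_right blinfun.scaleR_right)
    \<comment> \<open>The new term is the one at \<open>q = 0\<close>; the old ones move up by
      one.\<close>
    also have "\<dots> = (\<Sum>q\<le>Suc m. (c * inner (op_pow T (Suc m - q) y) y) *\<^sub>R op_pow S q y)"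
      by (simp add: sum.atMost_Suc_shift del: sum.atMost_Suc)
    finally show ?case .
  qed
qed

text \<open>Symmetric difference with \<open>{i}\<close>, an involution that reverses the sign at
  \<open>i\<close> only.\<close>

definition flip_in :: "'i \<Rightarrow> 'i set \<Rightarrow> 'i set"
  where "flip_in i A = (if i \<in> A then A - {i} else insert i A)"

lemma sgn_in_flip: "sgn_in (flip_in i A) j = (if j = i then - sgn_in A j else sgn_in A j)"
  by (cases "j = i"; cases "i \<in> A") (simp_all add: sgn_in_def flip_in_def)

lemma sum_flip_in:
  assumes "i \<in> I"
  shows "(\<Sum>A\<in>Pow I. f (flip_in i A)) = (\<Sum>A\<in>Pow I. f A)"
proof (rule sum.reindex_bij_witness[of _ "flip_in i" "flip_in i"])
  fix A
  show flip: "flip_in i (flip_in i A) = A"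
    unfolding flip_in_def by auto
  show "flip_in i (flip_in i A) = A" by (rule flip)
  assume "A \<in> Pow I"
  then show "flip_in i A \<in> Pow I" using assms by (auto simp: flip_in_def)
  then show "flip_in i A \<in> Pow I" .
qed simp

lemma signed_op_diff_flip:
  assumes "finite I" "i \<in> I"
  shows "signed_op I y A - signed_op I y (flip_in i A) = (2 * sgn_in A i) *\<^sub>R (y i \<otimes> y i)"
proof -
  have "signed_op I y A - signed_op I y (flip_in i A)
      = (\<Sum>j\<in>I. if j = i then (2 * sgn_in A i) *\<^sub>R (y i \<otimes> y i) else 0)"
    unfolding signed_op_def sum_subtractf[symmetric]
    by (intro sum.cong) (auto simp: sgn_in_flip scaleR_left_distrib[symmetric])
  then show ?thesis using assms by simp
qed

text \<open>The perturbation has coefficient \<open>2 * sgn_in A i\<close>. The outer sign cancels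
  the inner one, leaving twice a convolution of moments of even length \<open>2 * k\<close>, to
  which \<open>moment_convolution_le\<close> applies.\<close>

lemma signed_moment_diff_le:
  assumes "finite I" "i \<in> I"
  shows "sgn_in A i * (inner (op_pow (signed_op I y A) (2 * k + 1) (y i)) (y i)
      - inner (op_pow (signed_op I y (flip_in i A)) (2 * k + 1) (y i)) (y i))
    \<le> real (2 * k + 1) * (norm (y i))\<^sup>2 * ((norm (op_pow (signed_op I y A) k (y i)))\<^sup>2
      + (norm (op_pow (signed_op I y (flip_in i A)) k (y i)))\<^sup>2)"
proof -
  let ?S = "signed_op I y A" and ?T = "signed_op I y (flip_in i A)"
  note herm = hermitian_signed_op[of I y]
  have sq: "inner (op_pow (signed_op I y B) (2 * k) x) x = (norm (op_pow (signed_op I y B) k x))\<^sup>2" for B x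
    unfolding mult_2 hermitian_op_pow_inner[OF herm] by (rule dot_square_norm)
  have s2: "sgn_in A i * (2 * sgn_in A i * a) = 2 * a" for a by (simp add: sgn_in_def)
  have "inner (op_pow ?S (2 * k + 1) (y i)) (y i) - inner (op_pow ?T (2 * k + 1) (y i)) (y i)
      = (\<Sum>q\<le>2 * k. 2 * sgn_in A i * (inner (op_pow ?S q (y i)) (y i) * inner (op_pow ?T (2 * k - q) (y i)) (y i)))"
    unfolding inner_diff_left[symmetric] Suc_eq_plus1[symmetric]
      op_pow_diff_rank_one[OF herm signed_op_diff_flip[OF assms]]
    by (simp add: inner_sum_left mult_ac)
  then have "sgn_in A i * (inner (op_pow ?S (2 * k + 1) (y i)) (y i) - inner (op_pow ?T (2 * k + 1) (y i)) (y i))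
      = 2 * (\<Sum>q\<le>2 * k. inner (op_pow ?S q (y i)) (y i) * inner (op_pow ?T (2 * k - q) (y i)) (y i))"
    by (simp only: sum_distrib_left[symmetric] s2)
  also have "\<dots> \<le> real (2 * k + 1) * (norm (y i))\<^sup>2
      * (inner (op_pow ?S (2 * k) (y i)) (y i) + inner (op_pow ?T (2 * k) (y i)) (y i))"
    by (intro moment_convolution_le herm) simp
  finally show ?thesis unfolding sq .
qed

lemma sum_signed_trace_step:
  assumes "finite I" and M: "\<And>i. i \<in> I \<Longrightarrow> norm (y i) \<le> M"
  shows "(\<Sum>A\<in>Pow I. signed_trace I y A (2 * k + 1))
    \<le> real (2 * k + 1) * M\<^sup>2 * (\<Sum>A\<in>Pow I. \<Sum>i\<in>I. (norm (op_pow (signed_op I y A) k (y i)))\<^sup>2)"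
proof -
  define g where "g i A = inner (op_pow (signed_op I y A) (2 * k + 1) (y i)) (y i)" for i A
  define h where "h i A = (norm (op_pow (signed_op I y A) k (y i)))\<^sup>2" for i A
  have main: "(\<Sum>A\<in>Pow I. sgn_in A i * g i A) \<le> real (2 * k + 1) * M\<^sup>2 * (\<Sum>A\<in>Pow I. h i A)"
    if i: "i \<in> I" for i
  proof -
    have "(\<Sum>A\<in>Pow I. sgn_in A i * g i A) = (\<Sum>A\<in>Pow I. sgn_in (flip_in i A) i * g i (flip_in i A))"
      by (rule sum_flip_in[OF i, symmetric])
    \<comment> \<open>Averaging over the pattern and its flip replaces the moment by a difference,
      since the sign at \<open>i\<close> changes.\<close>
    then have "2 * (\<Sum>A\<in>Pow I. sgn_in A i * g i A)
        = (\<Sum>A\<in>Pow I. sgn_in A i * (g i A - g i (flip_in i A)))"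
      by (simp add: sgn_in_flip sum_negf sum_subtractf right_diff_distrib)
    also have "\<dots> \<le> (\<Sum>A\<in>Pow I. real (2 * k + 1) * M\<^sup>2 * (h i A + h i (flip_in i A)))"
    proof (rule sum_mono)
      fix A
      have "sgn_in A i * (g i A - g i (flip_in i A))
          \<le> real (2 * k + 1) * (norm (y i))\<^sup>2 * (h i A + h i (flip_in i A))"
        unfolding g_def h_def by (rule signed_moment_diff_le[OF \<open>finite I\<close> i])
      also have "\<dots> \<le> real (2 * k + 1) * M\<^sup>2 * (h i A + h i (flip_in i A))"
        by (intro mult_right_mono mult_left_mono power_mono M i) (auto simp: h_def)
      finally show "sgn_in A i * (g i A - g i (flip_in i A))
        \<le> real (2 * k + 1) * M\<^sup>2 * (h i A + h i (flip_in i A))" .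
    qed
    also have "\<dots> = real (2 * k + 1) * M\<^sup>2 * (\<Sum>A\<in>Pow I. h i A + h i (flip_in i A))"
      by (rule sum_distrib_left[symmetric])
    also have "\<dots> = 2 * (real (2 * k + 1) * M\<^sup>2 * (\<Sum>A\<in>Pow I. h i A))"
      unfolding sum.distrib sum_flip_in[OF i] by simp
    finally show ?thesis by simp
  qed
  have "(\<Sum>A\<in>Pow I. signed_trace I y A (2 * k + 1)) = (\<Sum>i\<in>I. \<Sum>A\<in>Pow I. sgn_in A i * g i A)"
    unfolding signed_trace_def g_def by (rule sum.swap)
  also have "\<dots> \<le> (\<Sum>i\<in>I. real (2 * k + 1) * M\<^sup>2 * (\<Sum>A\<in>Pow I. h i A))"
    by (intro sum_mono main)
  also have "\<dots> = real (2 * k + 1) * M\<^sup>2 * (\<Sum>i\<in>I. \<Sum>A\<in>Pow I. h i A)"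
    by (rule sum_distrib_left[symmetric])
  also have "(\<Sum>i\<in>I. \<Sum>A\<in>Pow I. h i A) = (\<Sum>A\<in>Pow I. \<Sum>i\<in>I. h i A)"
    by (rule sum.swap)
  finally show ?thesis unfolding h_def .
qed

section \<open>Moments and exponential moments of the signed sum\<close>

text \<open>The quotient of factorials is the double factorial \<open>(2 * k + 1)!!\<close>, a
  Gaussian moment: passing to \<open>Suc k\<close> contributes the factor \<open>2 * k + 3\<close>.
  The factor \<open>card I\<close> comes from the base case, and \<open>2 ^ card I\<close> counts
  the sign patterns, over which sums are not normalised.\<close>

lemma sum_signed_trace_le:
  assumes "finite I" and M: "\<And>i. i \<in> I \<Longrightarrow> norm (y i) \<le> M"
  shows "(\<Sum>A\<in>Pow I. signed_trace I y A (2 * k + 1))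
    \<le> 2 ^ card I * real (card I) * (fact (2 * Suc k) / (2 ^ Suc k * fact (Suc k)))
      * (M\<^sup>2 * norm (gram_op I y)) ^ Suc k"
proof (induction k)
  case 0
  have "(\<Sum>i\<in>I. (norm (y i))\<^sup>2) \<le> (\<Sum>i\<in>I. norm (gram_op I y))"
    by (intro sum_mono norm_sq_le_gram_op assms)
  then have "M\<^sup>2 * (\<Sum>A\<in>Pow I. \<Sum>i\<in>I. (norm (y i))\<^sup>2) \<le> M\<^sup>2 * (\<Sum>A\<in>Pow I. real (card I) * norm (gram_op I y))"
    by (intro mult_left_mono sum_mono) auto
  then show ?case
    using sum_signed_trace_step[where k = 0 and y = y, OF assms] \<open>finite I\<close> by (simp add: card_Pow mult_ac fact_numeral)
next
  case (Suc k)
  let ?K = "M\<^sup>2 * norm (gram_op I y)"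
  have "(\<Sum>A\<in>Pow I. signed_trace I y A (2 * Suc k + 1))
      \<le> real (2 * Suc k + 1) * M\<^sup>2 * (\<Sum>A\<in>Pow I. \<Sum>i\<in>I. (norm (op_pow (signed_op I y A) (Suc k) (y i)))\<^sup>2)"
    by (rule sum_signed_trace_step[OF assms])
  also have "\<dots> \<le> real (2 * Suc k + 1) * M\<^sup>2 * (\<Sum>A\<in>Pow I. norm (gram_op I y) * signed_trace I y A (2 * k + 1))"
    by (intro mult_left_mono sum_mono sum_norm_op_pow_le_trace hermitian_signed_op signed_trace_sums) auto
  also have "\<dots> = (real (2 * Suc k + 1) * ?K) * (\<Sum>A\<in>Pow I. signed_trace I y A (2 * k + 1))"
    by (simp add: sum_distrib_left[symmetric] mult_ac)
  also have "\<dots> \<le> (real (2 * Suc k + 1) * ?K) * (2 ^ card I * real (card I)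
      * (fact (2 * Suc k) / (2 ^ Suc k * fact (Suc k))) * ?K ^ Suc k)"
    by (intro mult_left_mono Suc) auto
  also have "\<dots> = 2 ^ card I * real (card I)
      * (real (2 * Suc k + 1) * (fact (2 * Suc k) / (2 ^ Suc k * fact (Suc k)))) * ?K ^ Suc (Suc k)"
    by (simp add: mult_ac)
  also have "real (2 * Suc k + 1) * (fact (2 * Suc k) / (2 ^ Suc k * fact (Suc k)))
      = fact (2 * Suc (Suc k)) / (2 ^ Suc (Suc k) * fact (Suc (Suc k)))"
  proof -
    have f2: "(fact (2 * Suc (Suc k)) :: real) = (2 * real k + 4) * (2 * real k + 3) * fact (2 * Suc k)"
      by (simp add: algebra_simps)
    have f1: "(fact (Suc (Suc k)) :: real) = (real k + 2) * fact (Suc k)"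
      by (simp add: algebra_simps)
    show ?thesis unfolding f1 f2 by (simp add: divide_simps del: fact_Suc) (simp add: algebra_simps)
  qed
  finally show ?case .
qed

text \<open>The power zero is treated apart: it has no trace in infinite dimension, and there
  \<open>1 \<le> card I\<close> suffices.\<close>

lemma rademacher_moment_le:
  assumes "finite I" "I \<noteq> {}" and M: "\<And>i. i \<in> I \<Longrightarrow> norm (y i) \<le> M"
  shows "(\<Sum>A\<in>Pow I. norm (signed_op I y A) ^ (2 * k))
    \<le> 2 ^ card I * real (card I) * (fact (2 * k) / (2 ^ k * fact k)) * (M\<^sup>2 * norm (gram_op I y)) ^ k"
proof (cases k)
  case 0
  have "1 \<le> real (card I)" using assms by (simp add: Suc_leI card_gt_0_iff)
  then show ?thesis using 0 \<open>finite I\<close> by (simp add: card_Pow)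
next
  case (Suc j)
  have "(\<Sum>A\<in>Pow I. norm (signed_op I y A) ^ (2 * k)) \<le> (\<Sum>A\<in>Pow I. signed_trace I y A (2 * j + 1))"
    unfolding Suc by (intro sum_mono norm_power_le_trace hermitian_signed_op signed_trace_sums)
  then show ?thesis
    using sum_signed_trace_le[where k = j and y = y, OF assms(1) M] unfolding Suc by linarith
qed

text \<open>Compare the series of \<open>cosh\<close> and \<open>exp\<close> term by term: dividing
  the Gaussian moment by \<open>fact (2 * k)\<close> leaves \<open>1 / (2 ^ k * fact k)\<close>.
  Only even moments are controlled, and \<open>exp x \<le> 2 * cosh x\<close> costs the factor
  2.\<close>

lemma rademacher_exp_le:
  assumes "finite I" "I \<noteq> {}" and M: "\<And>i. i \<in> I \<Longrightarrow> norm (y i) \<le> M"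
  shows "(\<Sum>A\<in>Pow I. exp (\<theta> * norm (signed_op I y A)))
    \<le> 2 ^ card I * (2 * real (card I) * exp (\<theta>\<^sup>2 * M\<^sup>2 * norm (gram_op I y) / 2))"
proof -
  define K where "K = M\<^sup>2 * norm (gram_op I y)"
  define C where "C = 2 ^ card I * real (card I)"
  have "(\<lambda>k. x ^ (2 * k) / fact (2 * k)) sums cosh x" for x :: real
  proof -
    have "strict_mono (\<lambda>k::nat. 2 * k)" by (simp add: strict_mono_def)
    then have "(\<lambda>k. (\<lambda>n. if even n then x ^ n /\<^sub>R fact n else 0) (2 * k)) sums cosh x"
      by (subst sums_mono_reindex) (auto intro: cosh_converges elim!: evenE)
    then show ?thesis by (simp add: field_simps)
  qed
  then have lhs: "(\<lambda>k. \<Sum>A\<in>Pow I. (\<theta> * norm (signed_op I y A)) ^ (2 * k) / fact (2 * k))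
      sums (\<Sum>A\<in>Pow I. cosh (\<theta> * norm (signed_op I y A)))"
    by (intro sums_sum)
  have rhs: "(\<lambda>k. C * ((\<theta>\<^sup>2 * K / 2) ^ k /\<^sub>R fact k)) sums (C * exp (\<theta>\<^sup>2 * K / 2))"
    by (intro sums_mult exp_converges)
  have le: "(\<Sum>A\<in>Pow I. (\<theta> * norm (signed_op I y A)) ^ (2 * k) / fact (2 * k))
      \<le> C * ((\<theta>\<^sup>2 * K / 2) ^ k /\<^sub>R fact k)" for k
  proof -
    have "(\<Sum>A\<in>Pow I. (\<theta> * norm (signed_op I y A)) ^ (2 * k) / fact (2 * k))
        = (\<theta>\<^sup>2) ^ k / fact (2 * k) * (\<Sum>A\<in>Pow I. norm (signed_op I y A) ^ (2 * k))"
      by (simp add: power_mult_distrib sum_distrib_left power_mult)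
    also have "\<dots> \<le> (\<theta>\<^sup>2) ^ k / fact (2 * k) * (C * (fact (2 * k) / (2 ^ k * fact k)) * K ^ k)"
      unfolding C_def K_def by (intro mult_left_mono rademacher_moment_le assms) auto
    also have "\<dots> = C * ((\<theta>\<^sup>2) ^ k * K ^ k / 2 ^ k / fact k)"
      by simp
    also have "\<dots> = C * ((\<theta>\<^sup>2 * K / 2) ^ k /\<^sub>R fact k)"
      unfolding power_mult_distrib power_divide by (simp add: divide_inverse)
    finally show ?thesis .
  qed
  have "(\<Sum>A\<in>Pow I. cosh (\<theta> * norm (signed_op I y A))) \<le> C * exp (\<theta>\<^sup>2 * K / 2)"
    by (rule sums_le[OF le lhs rhs])
  moreover have "exp x \<le> 2 * cosh x" for x :: real
    by (simp add: cosh_def)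
  then have "(\<Sum>A\<in>Pow I. exp (\<theta> * norm (signed_op I y A))) \<le> 2 * (\<Sum>A\<in>Pow I. cosh (\<theta> * norm (signed_op I y A)))"
    unfolding sum_distrib_left by (intro sum_mono)
  ultimately show ?thesis by (simp add: C_def K_def mult_ac)
qed

section \<open>Symmetrization\<close>

context prob_space
begin

lemma integrable_exp_bounded:
  fixes X :: "'a \<Rightarrow> real"
  assumes "random_variable borel X" "\<And>\<omega>. \<bar>X \<omega>\<bar> \<le> B"
  shows "integrable M (\<lambda>\<omega>. exp (c * X \<omega>))"
proof (rule integrable_const_bound[where B = "exp (\<bar>c\<bar> * B)"])
  have "c * X \<omega> \<le> \<bar>c\<bar> * B" for \<omega>
  proof -
    have "c * X \<omega> \<le> \<bar>c\<bar> * \<bar>X \<omega>\<bar>" by (metis abs_ge_self abs_mult)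
    also have "\<dots> \<le> \<bar>c\<bar> * B" by (intro mult_left_mono assms) simp
    finally show ?thesis .
  qed
  then show "AE \<omega> in M. norm (exp (c * X \<omega>)) \<le> exp (\<bar>c\<bar> * B)" by simp
qed (use assms(1) in measurable)

text \<open>The mean is given only pointwise in \<open>x\<close>, so the norm of \<open>A\<close> is
  bounded vector by vector by the mean norm; Jensen's inequality for \<open>exp\<close>
  follows.\<close>

lemma exp_norm_mean_le:
  fixes B :: "'a \<Rightarrow> (ell2 \<Rightarrow>\<^sub>L ell2)"
  assumes meas: "\<And>x. (\<lambda>v. blinfun_apply (B v) x) \<in> borel_measurable M"
    and bound: "\<And>v. norm (B v) \<le> K"
    and mean: "\<And>x. blinfun_apply A x = expectation (\<lambda>v. blinfun_apply (B v) x)"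
    and "0 \<le> s"
  shows "exp (s * norm A) \<le> expectation (\<lambda>v. exp (s * norm (B v)))"
proof -
  have nm: "(\<lambda>v. norm (B v)) \<in> borel_measurable M"
    by (rule norm_blinfun_measurable[OF meas])
  have int: "integrable M (\<lambda>v. norm (B v))"
    by (rule integrable_const_bound[where B = K]) (use bound nm in auto)
  have app: "norm (blinfun_apply (B v) x) \<le> norm (B v) * norm x" for v x
    by (rule norm_blinfun)
  have intx: "integrable M (\<lambda>v. blinfun_apply (B v) x)" for x
  proof (rule integrable_const_bound[where B = "K * norm x"])
    show "AE v in M. norm (blinfun_apply (B v) x) \<le> K * norm x"
      by (intro always_eventually allI order_trans[OF app] mult_right_mono bound) simp
  qed (rule meas)
  have "norm A \<le> expectation (\<lambda>v. norm (B v))"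
  proof (rule norm_blinfun_bound)
    fix x
    have "norm (blinfun_apply A x) \<le> expectation (\<lambda>v. norm (blinfun_apply (B v) x))"
      unfolding mean by (rule integral_norm_bound)
    also have "\<dots> \<le> expectation (\<lambda>v. norm (B v) * norm x)"
      by (intro integral_mono app integrable_norm intx integrable_mult_left int)
    finally show "norm (blinfun_apply A x) \<le> expectation (\<lambda>v. norm (B v)) * norm x" by simp
  qed simp
  then have "exp (s * norm A) \<le> exp (s * expectation (\<lambda>v. norm (B v)))"
    using \<open>0 \<le> s\<close> by (simp add: mult_left_mono)
  also have "\<dots> \<le> expectation (\<lambda>v. exp (s * norm (B v)))"
    by (rule jensens_inequality[where I = UNIV])
      (use bound nm int convex_on_exp[OF \<open>0 \<le> s\<close>] in
        \<open>auto intro!: integrable_exp_bounded[where B = K]\<close>)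
  finally show ?thesis .
qed

text \<open>Jensen's inequality for the concave power with exponent \<open>a\<close>; it closes the
  self-bounding inequality.\<close>

lemma expectation_exp_power_le:
  fixes X :: "'a \<Rightarrow> real"
  assumes X: "random_variable borel X" "\<And>\<omega>. \<bar>X \<omega>\<bar> \<le> B" and "0 \<le> a" "a \<le> 1"
  shows "expectation (\<lambda>\<omega>. exp (a * X \<omega>)) \<le> expectation (\<lambda>\<omega>. exp (X \<omega>)) powr a"
proof -
  let ?F = "expectation (\<lambda>\<omega>. exp (X \<omega>))"
  have int: "integrable M (\<lambda>\<omega>. exp (c * X \<omega>))" for c
    by (rule integrable_exp_bounded[OF X])
  have int1: "integrable M (\<lambda>\<omega>. exp (X \<omega>))" using int[of 1] by simp
  \<comment> \<open>Keeps \<open>?F\<close> away from 0, so that its logarithm can serve as the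
    centre.\<close>
  have "exp (- B) \<le> ?F"
  proof -
    have "expectation (\<lambda>\<omega>. exp (- B)) \<le> ?F"
      by (intro integral_mono int1) (use X(2) in \<open>auto simp: abs_le_iff minus_le_iff\<close>)
    then show ?thesis by (simp add: prob_space)
  qed
  then have F: "0 < ?F" by (rule less_le_trans[rotated]) simp
  define l where "l = ln ?F"
  have eF: "exp l = ?F" using F by (simp add: l_def)
  \<comment> \<open>convexity of \<open>exp\<close>, recentred at \<open>l = ln (E exp X)\<close>\<close>
  have pt: "exp (a * X \<omega>) \<le> exp (a * l) * (1 - a + a * exp (- l) * exp (X \<omega>))" for \<omega>
  proof -
    have "exp (a * (X \<omega> - l)) \<le> 1 - a + a * exp (X \<omega> - l)"
      using convex_onD[OF exp_convex, of a 0 "X \<omega> - l"] assms(3,4) by simp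
    then have "exp (a * l) * exp (a * (X \<omega> - l)) \<le> exp (a * l) * (1 - a + a * exp (X \<omega> - l))"
      by simp
    moreover have "exp (a * X \<omega>) = exp (a * l) * exp (a * (X \<omega> - l))"
      by (simp add: exp_add[symmetric] algebra_simps)
    moreover have "exp (X \<omega> - l) = exp (- l) * exp (X \<omega>)"
      by (simp add: exp_add[symmetric])
    ultimately show ?thesis by (simp only: mult.assoc)
  qed
  have "expectation (\<lambda>\<omega>. exp (a * X \<omega>))
      \<le> expectation (\<lambda>\<omega>. exp (a * l) * (1 - a + a * exp (- l) * exp (X \<omega>)))"
    by (intro integral_mono pt int integrable_mult_right Bochner_Integration.integrable_add int1
        integrable_const)
  also have "\<dots> = exp (a * l) * (1 - a + a * exp (- l) * ?F)"
    using int1 by (simp add: prob_space)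
  also have "\<dots> = exp (a * l)"
    unfolding eF[symmetric] by (simp add: exp_minus)
  also have "\<dots> = ?F powr a" using F by (simp add: powr_def l_def)
  finally show ?thesis .
qed

text \<open>Independent coordinates with one common law can be selected or permuted injectively.
  Used both for exchanging the two copies and for restricting to one of them.\<close>

lemma integral_PiM_reindex:
  fixes g :: "('i \<Rightarrow> 'a) \<Rightarrow> real"
  assumes "inj_on f I" "f \<in> I \<rightarrow> K" "g \<in> borel_measurable (PiM I (\<lambda>_. M))"
  shows "(\<integral>w. g (\<lambda>i\<in>I. w (f i)) \<partial>PiM K (\<lambda>_. M)) = (\<integral>u. g u \<partial>PiM I (\<lambda>_. M))"
proof -
  have "(\<integral>u. g u \<partial>PiM I (\<lambda>_. M))
      = (\<integral>u. g u \<partial>distr (PiM K (\<lambda>_. M)) (PiM I (\<lambda>_. M)) (\<lambda>w. \<lambda>i\<in>I. w (f i)))"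
    by (subst distr_PiM_reindex[OF prob_space_axioms assms(1,2)]) simp
  also have "\<dots> = (\<integral>w. g (\<lambda>i\<in>I. w (f i)) \<partial>PiM K (\<lambda>_. M))"
    using assms(2)
    by (intro integral_distr assms(3) measurable_restrict measurable_component_singleton) auto
  finally show ?thesis by simp
qed

end

lemma signed_op_cong: "(\<And>i. i \<in> I \<Longrightarrow> y i = z i) \<Longrightarrow> signed_op I y A = signed_op I z A"
  unfolding signed_op_def by (intro sum.cong) auto

lemma gram_op_cong: "(\<And>i. i \<in> I \<Longrightarrow> y i = z i) \<Longrightarrow> gram_op I y = gram_op I z"
  unfolding gram_op_def by (intro sum.cong) auto

lemma norm_tensor_self_le: "norm y \<le> b \<Longrightarrow> norm (y \<otimes> y) \<le> b\<^sup>2"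
proof (rule norm_blinfun_bound)
  fix x :: ell2 assume "norm y \<le> b"
  then have "norm y * norm y * norm x \<le> b * b * norm x"
    by (intro mult_right_mono mult_mono) (auto intro: order_trans[OF norm_ge_zero])
  then show "norm (blinfun_apply (y \<otimes> y) x) \<le> b\<^sup>2 * norm x"
    using norm_tensor_ell2_apply_le[of y y x] by (simp add: power2_eq_square)
qed simp

lemma norm_signed_op_le:
  assumes "\<And>i. i \<in> I \<Longrightarrow> norm (y i) \<le> b"
  shows "norm (signed_op I y A) \<le> real (card I) * b\<^sup>2"
proof -
  have "norm (signed_op I y A) \<le> (\<Sum>i\<in>I. norm (sgn_in A i *\<^sub>R (y i \<otimes> y i)))"
    unfolding signed_op_def by (rule norm_sum)
  also have "\<dots> \<le> (\<Sum>i\<in>I. b\<^sup>2)"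
    by (intro sum_mono) (simp add: sgn_in_def norm_tensor_self_le assms)
  finally show ?thesis by simp
qed

lemma gram_op_eq_signed_op: "gram_op I y = signed_op I y I"
  unfolding gram_op_def signed_op_def by (intro sum.cong) (auto simp: sgn_in_def)

section \<open>The sample and its deviation from the mean\<close>

text \<open>One draw is \<open>h v\<close> with \<open>v\<close> distributed by \<open>N\<close>;
  the sample lives on a power of \<open>N\<close>. In the application \<open>N\<close> is the law of
  \<open>y 1\<close> and \<open>h\<close> a truncation, which makes the bound hold
  everywhere.\<close>

locale bounded_vector_law = prob_space N for N :: "'b measure" +
  fixes h :: "'b \<Rightarrow> ell2" and b :: real and \<Lambda> :: "ell2 \<Rightarrow>\<^sub>L ell2" and n :: nat
  assumes h_measurable [measurable]: "h \<in> borel_measurable N"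
    and h_bound: "\<And>v. norm (h v) \<le> b"
    and second_moment: "\<And>x. blinfun_apply \<Lambda> x = expectation (\<lambda>v. blinfun_apply (h v \<otimes> h v) x)"
    and n_pos: "1 \<le> n"
begin

sublocale PN: product_prob_space "\<lambda>_::nat. N"
  by standard

definition deviation :: "(nat \<Rightarrow> 'b) \<Rightarrow> real"
  where "deviation u = norm (gram_op {1..n} (\<lambda>i. h (u i)) - real n *\<^sub>R \<Lambda>)"

lemma prob_space_sample: "prob_space (PiM K (\<lambda>_::nat. N))"
  by (intro prob_space_PiM prob_space_axioms)

lemma sample_measurable: "k \<in> K \<Longrightarrow> (\<lambda>w. h (w k)) \<in> borel_measurable (PiM K (\<lambda>_. N))"
  by measurable

lemma signed_op_apply_measurable:
  assumes "g ` I \<subseteq> K"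
  shows "(\<lambda>w. blinfun_apply (signed_op I (\<lambda>i. h (w (g i))) A) x) \<in> borel_measurable (PiM K (\<lambda>_. N))"
  unfolding signed_op_def blinfun.sum_left blinfun.scaleR_left
proof (intro borel_measurable_sum borel_measurable_scaleR borel_measurable_const measurable_tensor_apply)
  fix i assume "i \<in> I"
  then show "(\<lambda>w. h (w (g i))) \<in> borel_measurable (PiM K (\<lambda>_. N))"
    using assms by (intro sample_measurable) auto
qed

lemma norm_signed_op_measurable:
  assumes "g ` I \<subseteq> K"
  shows "(\<lambda>w. norm (signed_op I (\<lambda>i. h (w (g i))) A)) \<in> borel_measurable (PiM K (\<lambda>_. N))"
  by (intro norm_blinfun_measurable signed_op_apply_measurable assms)

lemma deviation_measurable:
  assumes "{1..n} \<subseteq> K"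
  shows "deviation \<in> borel_measurable (PiM K (\<lambda>_. N))"
  unfolding deviation_def gram_op_eq_signed_op
proof (rule norm_blinfun_measurable, unfold blinfun.diff_left)
  fix x
  show "(\<lambda>w. blinfun_apply (signed_op {1..n} (\<lambda>i. h (w i)) {1..n}) x - blinfun_apply (real n *\<^sub>R \<Lambda>) x)
      \<in> borel_measurable (PiM K (\<lambda>_. N))"
    using assms by (intro borel_measurable_diff borel_measurable_const signed_op_apply_measurable[where g = "\<lambda>i. i"]) auto
qed

lemma norm_signed_op_bound: "norm (signed_op I (\<lambda>i. h (w i)) A) \<le> real (card I) * b\<^sup>2"
  by (intro norm_signed_op_le h_bound)

lemma deviation_bound: "\<bar>deviation u\<bar> \<le> real n * b\<^sup>2 + norm (real n *\<^sub>R \<Lambda>)"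
proof -
  have "\<bar>deviation u\<bar> \<le> norm (gram_op {1..n} (\<lambda>i. h (u i))) + norm (real n *\<^sub>R \<Lambda>)"
    unfolding deviation_def abs_norm_cancel by (rule norm_triangle_ineq4)
  also have "\<dots> \<le> real n * b\<^sup>2 + norm (real n *\<^sub>R \<Lambda>)"
    using norm_signed_op_bound[of "{1..n}" u "{1..n}"] by (simp add: gram_op_eq_signed_op)
  finally show ?thesis .
qed

lemma mean_gram_op:
  assumes "{Suc n..2 * n} \<subseteq> K"
  shows "real n *\<^sub>R blinfun_apply \<Lambda> x
    = (\<integral>v. blinfun_apply (gram_op {1..n} (\<lambda>i. h (v (i + n)))) x \<partial>PiM K (\<lambda>_. N))"
proof -
  interpret K: prob_space "PiM K (\<lambda>_. N)" by (rule prob_space_sample)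
  have K: "i + n \<in> K" if "i \<in> {1..n}" for i using that assms by auto
  have int: "integrable (PiM K (\<lambda>_. N)) (\<lambda>v. blinfun_apply (h (v (i + n)) \<otimes> h (v (i + n))) x)"
    if "i \<in> {1..n}" for i
    by (intro K.integrable_tensor_apply[where K = b] sample_measurable K that always_eventually allI h_bound)
  have one: "(\<integral>v. blinfun_apply (h (v (i + n)) \<otimes> h (v (i + n))) x \<partial>PiM K (\<lambda>_. N)) = blinfun_apply \<Lambda> x"
    if "i \<in> {1..n}" for i
  proof -
    have "blinfun_apply \<Lambda> x = (\<integral>v. blinfun_apply (h v \<otimes> h v) x \<partial>distr (PiM K (\<lambda>_. N)) N (\<lambda>v. v (i + n)))"
      unfolding second_moment by (subst distr_PiM_component[OF prob_space_axioms K[OF that]]) simp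
    also have "\<dots> = (\<integral>v. blinfun_apply (h (v (i + n)) \<otimes> h (v (i + n))) x \<partial>PiM K (\<lambda>_. N))"
      using K[OF that] by (intro integral_distr) auto
    finally show ?thesis by simp
  qed
  have "(\<integral>v. blinfun_apply (gram_op {1..n} (\<lambda>i. h (v (i + n)))) x \<partial>PiM K (\<lambda>_. N))
      = (\<Sum>i\<in>{1..n}. blinfun_apply \<Lambda> x)"
    unfolding gram_op_def blinfun.sum_left
    by (subst Bochner_Integration.integral_sum[OF int]) (auto simp: one)
  then show ?thesis by (simp add: scaleR_conv_of_real[symmetric] sum_constant_scaleR)
qed

text \<open>The ghost sample occupies the coordinates \<open>n + 1, \<dots>, 2 n\<close>.\<close>

definition ghost_difference :: "(nat \<Rightarrow> 'b) \<Rightarrow> (ell2 \<Rightarrow>\<^sub>L ell2)"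
  where "ghost_difference w
    = gram_op {1..n} (\<lambda>i. h (w i)) - gram_op {1..n} (\<lambda>i. h (w (i + n)))"

lemma ghost_difference_bound: "norm (ghost_difference w) \<le> 2 * (real n * b\<^sup>2)"
proof -
  have "norm (ghost_difference w)
      \<le> norm (gram_op {1..n} (\<lambda>i. h (w i))) + norm (gram_op {1..n} (\<lambda>i. h (w (i + n))))"
    unfolding ghost_difference_def by (rule norm_triangle_ineq4)
  also have "\<dots> \<le> real n * b\<^sup>2 + real n * b\<^sup>2"
    using norm_signed_op_bound[of "{1..n}" w "{1..n}"] norm_signed_op_bound[of "{1..n}" "\<lambda>i. w (i + n)" "{1..n}"]
    unfolding gram_op_eq_signed_op by (intro add_mono) auto
  finally show ?thesis by simp
qed

lemma norm_ghost_difference_measurable: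
  "(\<lambda>w. norm (ghost_difference w)) \<in> borel_measurable (PiM {1..2 * n} (\<lambda>_. N))"
proof (rule norm_blinfun_measurable)
  fix x
  show "(\<lambda>w. blinfun_apply (ghost_difference w) x) \<in> borel_measurable (PiM {1..2 * n} (\<lambda>_. N))"
    unfolding ghost_difference_def gram_op_eq_signed_op blinfun.diff_left
    by (intro borel_measurable_diff signed_op_apply_measurable[where g = "\<lambda>i. i"]
        signed_op_apply_measurable[where g = "\<lambda>i. i + n"]) auto
qed

text \<open>With the first sample \<open>u\<close> fixed, \<open>n\<close> times
  \<open>\<Lambda>\<close> is the mean of the ghost sum, so \<open>exp_norm_mean_le\<close> applies
  to the inner integral; Fubini then joins both samples.\<close>

lemma exp_deviation_le_ghost:
  assumes "0 \<le> s"
  shows "(\<integral>u. exp (s * deviation u) \<partial>PiM {1..n} (\<lambda>_. N))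
    \<le> (\<integral>w. exp (s * norm (ghost_difference w)) \<partial>PiM {1..2 * n} (\<lambda>_. N))"
proof -
  let ?I = "{1..n}" and ?J = "{Suc n..2 * n}"
  let ?f = "\<lambda>w. exp (s * norm (ghost_difference w))"
  interpret I: prob_space "PiM ?I (\<lambda>_. N)" by (rule prob_space_sample)
  interpret J: prob_space "PiM ?J (\<lambda>_. N)" by (rule prob_space_sample)
  interpret W: prob_space "PiM {1..2 * n} (\<lambda>_. N)" by (rule prob_space_sample)
  have IJ: "?I \<union> ?J = {1..2 * n}" "?I \<inter> ?J = {}" by auto
  have f_int: "integrable (PiM {1..2 * n} (\<lambda>_. N)) ?f"
    by (rule W.integrable_exp_bounded[OF norm_ghost_difference_measurable, where B = "2 * (real n * b\<^sup>2)"])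
      (use ghost_difference_bound in auto)
  have split: "ghost_difference (merge ?I ?J (u, v))
      = gram_op ?I (\<lambda>i. h (u i)) - gram_op ?I (\<lambda>i. h (v (i + n)))" for u v
    unfolding ghost_difference_def by (intro arg_cong2[where f = minus] gram_op_cong) (auto simp: merge_def)
  have inner: "exp (s * deviation u) \<le> (\<integral>v. ?f (merge ?I ?J (u, v)) \<partial>PiM ?J (\<lambda>_. N))" for u
    unfolding deviation_def
  proof (rule J.exp_norm_mean_le[OF _ _ _ assms])
    let ?A = "gram_op ?I (\<lambda>i. h (u i))" and ?B = "\<lambda>v. gram_op ?I (\<lambda>i. h (v (i + n)))"
    have meas: "(\<lambda>v. blinfun_apply (?B v) x) \<in> borel_measurable (PiM ?J (\<lambda>_. N))" for x
      unfolding gram_op_eq_signed_op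
      by (intro signed_op_apply_measurable[where g = "\<lambda>i. i + n"]) auto
    fix x
    show "(\<lambda>v. blinfun_apply (ghost_difference (merge ?I ?J (u, v))) x) \<in> borel_measurable (PiM ?J (\<lambda>_. N))"
      unfolding split blinfun.diff_left by (intro borel_measurable_diff borel_measurable_const meas)
    have "integrable (PiM ?J (\<lambda>_. N)) (\<lambda>v. blinfun_apply (?B v) x)"
    proof (rule J.integrable_const_bound[where B = "real n * b\<^sup>2 * norm x"])
      show "AE v in PiM ?J (\<lambda>_. N). norm (blinfun_apply (?B v) x) \<le> real n * b\<^sup>2 * norm x"
        using norm_signed_op_bound[of ?I _ ?I] unfolding gram_op_eq_signed_op
        by (intro always_eventually allI order_trans[OF norm_blinfun] mult_right_mono) auto
    qed (rule meas)
    then show "blinfun_apply (?A - real n *\<^sub>R \<Lambda>) x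
        = (\<integral>v. blinfun_apply (ghost_difference (merge ?I ?J (u, v))) x \<partial>PiM ?J (\<lambda>_. N))"
      unfolding split blinfun.diff_left blinfun.scaleR_left mean_gram_op[OF order_refl]
      by (simp add: J.prob_space)
  qed (rule ghost_difference_bound)
  have pair_meas: "(\<lambda>(u, v). ?f (merge ?I ?J (u, v))) \<in> borel_measurable (PiM ?I (\<lambda>_. N) \<Otimes>\<^sub>M PiM ?J (\<lambda>_. N))"
    using measurable_compose[OF measurable_merge borel_measurable_integrable[OF f_int[folded IJ(1)]]]
    by (simp add: split_beta')
  have outer_int: "integrable (PiM ?I (\<lambda>_. N)) (\<lambda>u. \<integral>v. ?f (merge ?I ?J (u, v)) \<partial>PiM ?J (\<lambda>_. N))"
  proof (rule I.integrable_const_bound[where B = "exp (s * (2 * (real n * b\<^sup>2)))"])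
    have "norm (\<integral>v. ?f (merge ?I ?J (u, v)) \<partial>PiM ?J (\<lambda>_. N)) \<le> exp (s * (2 * (real n * b\<^sup>2)))" for u
    proof -
      have "norm (\<integral>v. ?f (merge ?I ?J (u, v)) \<partial>PiM ?J (\<lambda>_. N))
          \<le> (\<integral>v. exp (s * (2 * (real n * b\<^sup>2))) \<partial>PiM ?J (\<lambda>_. N))"
        by (rule integral_norm_bound[THEN order_trans], rule integral_mono')
          (use ghost_difference_bound assms in \<open>auto intro!: mult_left_mono\<close>)
      then show ?thesis by (simp add: J.prob_space)
    qed
    then show "AE u in PiM ?I (\<lambda>_. N). norm (\<integral>v. ?f (merge ?I ?J (u, v)) \<partial>PiM ?J (\<lambda>_. N))
        \<le> exp (s * (2 * (real n * b\<^sup>2)))" by simp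
  qed (rule J.borel_measurable_lebesgue_integral[OF pair_meas])
  have "(\<integral>u. exp (s * deviation u) \<partial>PiM ?I (\<lambda>_. N))
      \<le> (\<integral>u. (\<integral>v. ?f (merge ?I ?J (u, v)) \<partial>PiM ?J (\<lambda>_. N)) \<partial>PiM ?I (\<lambda>_. N))"
    by (intro integral_mono inner outer_int I.integrable_exp_bounded[OF deviation_measurable deviation_bound]) simp
  also have "\<dots> = (\<integral>w. ?f w \<partial>PiM (?I \<union> ?J) (\<lambda>_. N))"
    by (rule PN.product_integral_fold[symmetric]) (use f_int IJ in auto)
  finally show ?thesis unfolding IJ .
qed

text \<open>Exchanges the two copies of coordinate \<open>i\<close> for every \<open>i \<le> n\<close> outside \<open>A\<close>; for \<open>k \<le> n\<close> the
  truncated \<open>k - n\<close> is \<open>0\<close>, which is not in \<open>A\<close>.\<close>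

definition swap_index :: "nat set \<Rightarrow> nat \<Rightarrow> nat"
  where "swap_index A k = (if k \<in> A \<or> k - n \<in> A then k else if k \<le> n then k + n else k - n)"

lemma swap_index_simps:
  assumes "A \<subseteq> {1..n}" "i \<in> {1..n}"
  shows "swap_index A i = (if i \<in> A then i else i + n)"
    "swap_index A (i + n) = (if i \<in> A then i + n else i)"
  using assms by (auto simp: swap_index_def)

lemma swap_index_invol:
  assumes "A \<subseteq> {1..n}" "k \<in> {1..2 * n}"
  shows "swap_index A k \<in> {1..2 * n} \<and> swap_index A (swap_index A k) = k"
proof (cases "k \<le> n")
  case True
  then show ?thesis using swap_index_simps[OF assms(1), of k] assms(2) by auto
next
  case False
  moreover define i where "i = k - n"
  ultimately have "k = i + n" "i \<in> {1..n}"
    using assms(2) by auto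
  then show ?thesis using swap_index_simps[OF assms(1), of i] by auto
qed

text \<open>Exchanging the copies of \<open>i\<close> negates the \<open>i\<close>-th difference,
  which creates the sign at \<open>i\<close>.\<close>

lemma ghost_difference_swap:
  assumes "A \<subseteq> {1..n}"
  shows "ghost_difference (\<lambda>k\<in>{1..2 * n}. w (swap_index A k))
    = signed_op {1..n} (\<lambda>i. h (w i)) A - signed_op {1..n} (\<lambda>i. h (w (i + n))) A"
  unfolding ghost_difference_def gram_op_def signed_op_def sum_subtractf[symmetric]
  by (intro sum.cong) (auto simp: swap_index_simps[OF assms] sgn_in_def)

text \<open>The swap preserves the product law, so it may be applied for each fixed
  \<open>A\<close>. The two resulting signed sums have the same law.\<close>

lemma exp_ghost_le_signed:
  assumes "0 \<le> s" "A \<subseteq> {1..n}"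
  shows "(\<integral>w. exp (s * norm (ghost_difference w)) \<partial>PiM {1..2 * n} (\<lambda>_. N))
    \<le> (\<integral>u. exp (2 * s * norm (signed_op {1..n} (\<lambda>i. h (u i)) A)) \<partial>PiM {1..n} (\<lambda>_. N))"
proof -
  let ?I = "{1..n}" and ?W = "PiM {1..2 * n} (\<lambda>_. N)"
  interpret W: prob_space ?W by (rule prob_space_sample)
  define g where "g u = exp (2 * s * norm (signed_op ?I (\<lambda>i. h (u i)) A))" for u
  have g_meas: "g \<in> borel_measurable (PiM ?I (\<lambda>_. N))"
    unfolding g_def
    by (intro measurable_compose[OF _ borel_measurable_exp] borel_measurable_times borel_measurable_const
        norm_signed_op_measurable[where g = "\<lambda>i. i"]) auto
  have g_restrict: "g (\<lambda>i\<in>?I. w (f i)) = g (\<lambda>i. w (f i))" for w and f :: "nat \<Rightarrow> nat"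
    unfolding g_def by (auto intro!: signed_op_cong arg_cong[where f = norm])
  have g_int: "integrable ?W (\<lambda>w. g (\<lambda>i. w (f i)))" if "f ` ?I \<subseteq> {1..2 * n}" for f :: "nat \<Rightarrow> nat"
    unfolding g_def
    by (rule W.integrable_exp_bounded[OF norm_signed_op_measurable[OF that], where B = "real n * b\<^sup>2"])
      (use norm_signed_op_bound[of ?I] in auto)
  have g_eq: "(\<integral>w. g (\<lambda>i. w (f i)) \<partial>?W) = (\<integral>u. g u \<partial>PiM ?I (\<lambda>_. N))"
    if "inj_on f ?I" "f \<in> ?I \<rightarrow> {1..2 * n}" for f :: "nat \<Rightarrow> nat"
    using integral_PiM_reindex[OF that g_meas] unfolding g_restrict .
  have inj: "inj_on (swap_index A) {1..2 * n}"
    by (rule inj_on_inverseI[of _ "swap_index A"]) (use swap_index_invol[OF assms(2)] in auto)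
  have pt: "exp (s * norm (ghost_difference (\<lambda>k\<in>{1..2 * n}. w (swap_index A k))))
      \<le> (g (\<lambda>i. w i) + g (\<lambda>i. w (i + n))) / 2" for w
  proof -
    let ?a = "s * norm (signed_op ?I (\<lambda>i. h (w i)) A)"
      and ?b = "s * norm (signed_op ?I (\<lambda>i. h (w (i + n))) A)"
    have "s * norm (ghost_difference (\<lambda>k\<in>{1..2 * n}. w (swap_index A k))) \<le> ?a + ?b"
      unfolding ghost_difference_swap[OF assms(2)] distrib_left[symmetric]
      by (intro mult_left_mono norm_triangle_ineq4 assms)
    then have "exp (s * norm (ghost_difference (\<lambda>k\<in>{1..2 * n}. w (swap_index A k)))) \<le> exp ?a * exp ?b"
      by (simp add: exp_add[symmetric])
    \<comment> \<open>Separates the two samples pointwise, at the price of doubling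
      \<open>s\<close>.\<close>
    also have "\<dots> \<le> ((exp ?a)\<^sup>2 + (exp ?b)\<^sup>2) / 2"
      using sum_squares_bound[of "exp ?a" "exp ?b"] by simp
    finally show ?thesis by (simp add: g_def exp_double[symmetric] mult.assoc)
  qed
  have "(\<integral>w. exp (s * norm (ghost_difference w)) \<partial>?W)
      = (\<integral>w. exp (s * norm (ghost_difference (\<lambda>k\<in>{1..2 * n}. w (swap_index A k)))) \<partial>?W)"
  proof (rule integral_PiM_reindex[OF inj, symmetric])
    show "swap_index A \<in> {1..2 * n} \<rightarrow> {1..2 * n}" using swap_index_invol[OF assms(2)] by blast
    show "(\<lambda>w. exp (s * norm (ghost_difference w))) \<in> borel_measurable ?W"
      by (intro measurable_compose[OF _ borel_measurable_exp] borel_measurable_times borel_measurable_const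
          norm_ghost_difference_measurable)
  qed
  also have "\<dots> \<le> (\<integral>w. (g (\<lambda>i. w i) + g (\<lambda>i. w (i + n))) / 2 \<partial>?W)"
    by (rule integral_mono')
      (use pt g_int[of "\<lambda>i. i"] g_int[of "\<lambda>i. i + n"] in \<open>auto simp: g_def add_nonneg_nonneg\<close>)
  also have "\<dots> = ((\<integral>w. g (\<lambda>i. w i) \<partial>?W) + (\<integral>w. g (\<lambda>i. w (i + n)) \<partial>?W)) / 2"
    using g_int[of "\<lambda>i. i"] g_int[of "\<lambda>i. i + n"] by simp
  also have "\<dots> = (\<integral>u. g u \<partial>PiM ?I (\<lambda>_. N))"
    using g_eq[of "\<lambda>i. i"] g_eq[of "\<lambda>i. i + n"] by simp
  finally show ?thesis unfolding g_def .
qed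

lemma exp_deviation_le:
  assumes "norm \<Lambda> \<le> 1" "0 \<le> s" "2 * s * b\<^sup>2 \<le> 1"
  defines "a \<equiv> 2 * s * b\<^sup>2" and "F \<equiv> (\<integral>u. exp (s * deviation u) \<partial>PiM {1..n} (\<lambda>_. N))"
  shows "F \<le> 2 * real n * exp (a * s * real n) * F powr a"
proof -
  let ?I = "{1..n}" and ?Q = "PiM {1..n} (\<lambda>_. N)"
  interpret Q: prob_space ?Q by (rule prob_space_sample)
  let ?S = "\<lambda>u A. signed_op ?I (\<lambda>i. h (u i)) A" and ?G = "\<lambda>u. gram_op ?I (\<lambda>i. h (u i))"
  have S_int: "integrable ?Q (\<lambda>u. exp (c * norm (?S u A)))" for c A
    by (rule Q.integrable_exp_bounded[OF norm_signed_op_measurable[where g = "\<lambda>i. i"], where B = "real n * b\<^sup>2"])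
      (use norm_signed_op_bound[of ?I] in auto)
  have D_int: "integrable ?Q (\<lambda>u. exp (c * deviation u))" for c
    by (rule Q.integrable_exp_bounded[OF deviation_measurable deviation_bound]) simp
  \<comment> \<open>The ghost bound holds for every pattern, so it may be summed over all
    \<open>2 ^ n\<close> of them before the Rademacher estimate is applied with
    \<open>\<theta> = 2 * s\<close>.\<close>
  have "2 ^ n * F = (\<Sum>A\<in>Pow ?I. F)" by (simp add: card_Pow)
  also have "\<dots> \<le> (\<Sum>A\<in>Pow ?I. \<integral>u. exp (2 * s * norm (?S u A)) \<partial>?Q)"
    unfolding F_def using assms(2)
    by (intro sum_mono order_trans[OF exp_deviation_le_ghost exp_ghost_le_signed]) auto
  also have "\<dots> = (\<integral>u. (\<Sum>A\<in>Pow ?I. exp (2 * s * norm (?S u A))) \<partial>?Q)"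
    by (rule Bochner_Integration.integral_sum[symmetric]) (rule S_int)
  also have "\<dots> \<le> (\<integral>u. 2 ^ n * (2 * real n * exp (a * s * real n)) * exp (a * (s * deviation u)) \<partial>?Q)"
  proof (rule integral_mono)
    show "integrable ?Q (\<lambda>u. \<Sum>A\<in>Pow ?I. exp (2 * s * norm (?S u A)))"
      by (intro Bochner_Integration.integrable_sum S_int)
    show "integrable ?Q (\<lambda>u. 2 ^ n * (2 * real n * exp (a * s * real n)) * exp (a * (s * deviation u)))"
      using D_int[of "a * s"] by (intro integrable_mult_right) (simp add: mult.assoc)
    fix u
    have "?I \<noteq> {}" using n_pos by simp
    then have "(\<Sum>A\<in>Pow ?I. exp (2 * s * norm (?S u A)))
        \<le> 2 ^ card ?I * (2 * real (card ?I) * exp ((2 * s)\<^sup>2 * b\<^sup>2 * norm (?G u) / 2))"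
      by (intro rademacher_exp_le h_bound) auto
    also have "(2 * s)\<^sup>2 * b\<^sup>2 * norm (?G u) / 2 = a * s * norm (?G u)"
      by (simp add: a_def power2_eq_square)
    also have "norm (?G u) \<le> real n + deviation u"
    proof -
      have "norm (?G u) \<le> norm (real n *\<^sub>R \<Lambda>) + deviation u"
        unfolding deviation_def by (metis add.commute diff_add_cancel norm_triangle_ineq)
      moreover have "norm (real n *\<^sub>R \<Lambda>) \<le> real n"
        using assms(1) by (simp add: mult_left_le)
      ultimately show ?thesis by simp
    qed
    finally show "(\<Sum>A\<in>Pow ?I. exp (2 * s * norm (?S u A)))
        \<le> 2 ^ n * (2 * real n * exp (a * s * real n)) * exp (a * (s * deviation u))"
      using assms(2) by (simp add: a_def exp_add[symmetric] distrib_left mult.assoc mult_left_mono)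
  qed
  also have "\<dots> = 2 ^ n * (2 * real n * exp (a * s * real n)) * (\<integral>u. exp (a * (s * deviation u)) \<partial>?Q)"
    by simp
  also have "\<dots> \<le> 2 ^ n * (2 * real n * exp (a * s * real n)) * F powr a"
  proof (intro mult_left_mono)
    show "(\<integral>u. exp (a * (s * deviation u)) \<partial>?Q) \<le> F powr a"
      unfolding F_def
    proof (rule Q.expectation_exp_power_le[where B = "s * (real n * b\<^sup>2 + norm (real n *\<^sub>R \<Lambda>))"])
      show "(\<lambda>u. s * deviation u) \<in> borel_measurable ?Q"
        by (intro borel_measurable_times borel_measurable_const deviation_measurable) simp
      show "\<bar>s * deviation u\<bar> \<le> s * (real n * b\<^sup>2 + norm (real n *\<^sub>R \<Lambda>))" for u
        unfolding abs_mult using assms(2) by (intro mult_mono deviation_bound) auto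
    qed (use assms(2,3) in \<open>auto simp: a_def\<close>)
  qed simp
  finally show ?thesis by simp
qed

end

section \<open>The tail bound\<close>

text \<open>Here \<open>x\<close> stands for \<open>t^2 * n / M^2\<close>. Taking logarithms solves
  the self-bounding inequality for \<open>F\<close>.\<close>

lemma tail_bound_from_self_bound:
  fixes F x a p :: real and n :: nat
  assumes F: "0 < F" "F \<le> 2 * real n * exp (x / 32) * F powr a"
    and "a \<le> 1 / 4" "2 \<le> n" "0 \<le> x" and p: "p \<le> 1" "p \<le> exp (- (x / 8)) * F"
  shows "p \<le> 2 powr (3 / 4) * real n * exp (- (x / 21))"
proof -
  define L where "L = ln F"
  define B where "B = 3 / 4 * ln 2 + ln (real n)"
  have n: "0 < real n" using assms by simp
  have B: "2 powr (3 / 4) * real n * exp (- (x / 21)) = exp (B - x / 21)"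
  proof -
    have "exp (B - x / 21) = exp (3 / 4 * ln 2 + ln (real n) + - (x / 21))"
      by (simp add: B_def)
    also have "\<dots> = 2 powr (3 / 4) * real n * exp (- (x / 21))"
      unfolding exp_add using n by (simp add: powr_def)
    finally show ?thesis by simp
  qed
  have ln_n: "ln 2 \<le> ln (real n)" "0 < ln (2 :: real)" using assms n by simp_all
  show ?thesis
  \<comment> \<open>In the first case the claimed bound is at least 1; otherwise \<open>x\<close>
    exceeds \<open>21 * B\<close>.\<close>
  proof (cases "x / 21 \<le> B")
    case True
    then have "1 \<le> exp (B - x / 21)" by simp
    then show ?thesis unfolding B using p(1) by linarith
  next
    case False
    have "L \<le> ln (2 * real n * exp (x / 32) * F powr a)"
      unfolding L_def using F n by (subst ln_le_cancel_iff) auto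
    also have "\<dots> = ln 2 + ln (real n) + x / 32 + a * L"
      using F(1) n by (simp add: ln_mult L_def ln_powr)
    finally have L: "(1 - a) * L \<le> ln 2 + ln (real n) + x / 32" by (simp add: algebra_simps)
    have "3 / 4 * L \<le> ln 2 + ln (real n) + x / 32"
    proof (cases "0 \<le> L")
      case True
      then have "3 / 4 * L \<le> (1 - a) * L" using \<open>a \<le> 1 / 4\<close> by (intro mult_right_mono) auto
      then show ?thesis using L by linarith
    next
      case False
      then show ?thesis using ln_n \<open>0 \<le> x\<close> by linarith
    qed
    \<comment> \<open>After \<open>L \<le> 4/3 * ln (2 * n) + x / 24\<close> there remains
      \<open>7/12 * ln 2 + 1/3 * ln n \<le> x / 28\<close>. The right side exceeds
      \<open>3/4 * B = 9/16 * ln 2 + 3/4 * ln n\<close>, which is enough because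
      \<open>ln 2 \<le> ln n\<close>.\<close>
    then have "L - x / 8 \<le> B - x / 21"
      using False ln_n unfolding B_def by linarith
    then have "exp (- (x / 8) + L) \<le> exp (B - x / 21)" by simp
    then have "exp (- (x / 8)) * F \<le> exp (B - x / 21)"
      unfolding exp_add using F(1) by (simp add: L_def)
    then show ?thesis unfolding B using p(2) by (rule order_trans[rotated])
  qed
qed

theorem theorem1p1:
  fixes P :: "'w measure"
    and y :: "nat \<Rightarrow> 'w \<Rightarrow> ell2"
    and n :: nat
    and M t :: real
    and \<Lambda> :: "ell2 \<Rightarrow>\<^sub>L ell2"
  assumes "prob_space P"
    and "n \<ge> 3"
    and "prob_space.indep_vars P (\<lambda>_. borel) y {1..n}"
    and "\<And>i j. i \<in> {1..n} \<Longrightarrow> j \<in> {1..n} \<Longrightarrow> distr P borel (y i) = distr P borel (y j)"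
    and "M > 0"
    and "\<And>i. i \<in> {1..n} \<Longrightarrow> AE \<omega> in P. norm (y i \<omega>) \<le> M"
    and "\<And>i. i \<in> {1..n} \<Longrightarrow> \<Lambda> = op_expectation P (\<lambda>\<omega>. y i \<omega> \<otimes> y i \<omega>)"
    and "norm \<Lambda> \<le> 1"
    and "0 < t" and "t \<le> 1"
  shows "measure P {\<omega> \<in> space P. norm ((1 / real n) *\<^sub>R (\<Sum>i=1..n. y i \<omega> \<otimes> y i \<omega>) - \<Lambda>) \<ge> t}
    \<le> 2 powr (3 / 4) * real n * exp (- (t\<^sup>2 * real n / (21 * M\<^sup>2)))"
proof -
  interpret P: prob_space P by fact
  let ?I = "{1..n}"
  have one: "1 \<in> ?I" and n_pos: "0 < real n" using \<open>n \<ge> 3\<close> by auto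
  have rv: "y i \<in> borel_measurable P" if "i \<in> ?I" for i
    using assms(3) that by (auto simp: P.indep_vars_def)
  define N where "N = distr P borel (y 1)"
  \<comment> \<open>truncation makes all bounds hold everywhere and not only almost surely\<close>
  define h where "h v = (if norm v \<le> M then v else 0)" for v :: ell2
  have sets_N [measurable_cong]: "sets N = sets borel" by (simp add: N_def)
  have h_borel: "h \<in> borel_measurable borel" unfolding h_def by measurable
  interpret N: bounded_vector_law N h M \<Lambda> n
  proof (intro bounded_vector_law.intro bounded_vector_law_axioms.intro)
    show "prob_space N" unfolding N_def by (intro P.prob_space_distr rv one)
    show "h \<in> borel_measurable N" using h_borel by measurable
    show "norm (h v) \<le> M" for v using \<open>M > 0\<close> by (simp add: h_def)
    show "1 \<le> n" using \<open>n \<ge> 3\<close> by simp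
    fix x
    have hy: "(\<lambda>\<omega>. h (y 1 \<omega>)) \<in> borel_measurable P"
      by (rule measurable_compose[OF rv[OF one] h_borel])
    have "blinfun_apply \<Lambda> x = (\<integral>\<omega>. blinfun_apply (y 1 \<omega> \<otimes> y 1 \<omega>) x \<partial>P)"
      unfolding assms(7)[OF one] by (rule P.op_expectation_tensor_apply[OF rv[OF one] assms(6)[OF one]])
    also have "\<dots> = (\<integral>\<omega>. blinfun_apply (h (y 1 \<omega>) \<otimes> h (y 1 \<omega>)) x \<partial>P)"
      using assms(6)[OF one]
      by (intro integral_cong_AE measurable_tensor_apply rv one hy) (auto simp: h_def)
    also have "\<dots> = (\<integral>v. blinfun_apply (h v \<otimes> h v) x \<partial>N)"
      unfolding N_def by (intro integral_distr[symmetric] rv one measurable_tensor_apply h_borel)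
    finally show "blinfun_apply \<Lambda> x = (\<integral>v. blinfun_apply (h v \<otimes> h v) x \<partial>N)" .
  qed
  let ?Q = "PiM ?I (\<lambda>_. N)"
  define U where "U \<omega> = (\<lambda>i\<in>?I. y i \<omega>)" for \<omega>
  have U_meas: "U \<in> measurable P ?Q"
    unfolding U_def by (intro measurable_restrict) (use rv in \<open>simp add: measurable_cong_sets[OF refl sets_N]\<close>)
  \<comment> \<open>Independence and equal laws make the joint law a power of
    \<open>N\<close>.\<close>
  have U_law: "distr P ?Q U = ?Q"
  proof -
    have "?Q = PiM ?I (\<lambda>i. distr P borel (y i))"
      unfolding N_def by (intro PiM_cong refl assms(4) one)
    also have "\<dots> = distr P (PiM ?I (\<lambda>_. borel)) (\<lambda>\<omega>. \<lambda>i\<in>?I. y i \<omega>)"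
      using assms(3) one rv by (subst (asm) P.indep_vars_iff_distr_eq_PiM') auto
    also have "\<dots> = distr P ?Q U"
      unfolding U_def by (intro distr_cong refl sets_PiM_cong) (simp add: sets_N)
    finally show ?thesis by simp
  qed
  \<comment> \<open>This makes the exponent \<open>2 * s * M^2\<close> equal to
    \<open>t / 4\<close>, hence at most \<open>1 / 4\<close>.\<close>
  define s where "s = t / (8 * M\<^sup>2)"
  define x where "x = t\<^sup>2 * real n / M\<^sup>2"
  define F where "F = (\<integral>u. exp (s * N.deviation u) \<partial>?Q)"
  have s_pos: "0 < s" using assms by (simp add: s_def)
  have a: "2 * s * M\<^sup>2 = t / 4" using \<open>M > 0\<close> by (simp add: s_def)
  have ax: "t / 4 * s * real n = x / 32" by (simp add: s_def x_def power2_eq_square)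
  have sx: "s * (real n * t) = x / 8" by (simp add: s_def x_def power2_eq_square mult_ac)
  have dev_U: "(\<lambda>\<omega>. N.deviation (U \<omega>)) \<in> borel_measurable P"
    by (rule measurable_compose[OF U_meas N.deviation_measurable]) simp
  have int: "integrable P (\<lambda>\<omega>. exp (s * N.deviation (U \<omega>)))"
    by (rule P.integrable_exp_bounded[OF dev_U N.deviation_bound])
  have F: "F = (\<integral>\<omega>. exp (s * N.deviation (U \<omega>)) \<partial>P)"
  proof -
    have "F = (\<integral>u. exp (s * N.deviation u) \<partial>distr P ?Q U)" unfolding F_def U_law ..
    also have "\<dots> = (\<integral>\<omega>. exp (s * N.deviation (U \<omega>)) \<partial>P)"
      by (intro integral_distr U_meas measurable_compose[OF _ borel_measurable_exp] borel_measurable_times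
          borel_measurable_const N.deviation_measurable order_refl)
    finally show ?thesis .
  qed
  \<comment> \<open>Provides the positivity required for taking logarithms.\<close>
  have "1 \<le> F"
  proof -
    have "(\<integral>\<omega>. 1 \<partial>P) \<le> F"
      unfolding F by (intro integral_mono int) (use s_pos in \<open>auto simp: N.deviation_def\<close>)
    then show ?thesis by (simp add: P.prob_space)
  qed
  have self: "F \<le> 2 * real n * exp (x / 32) * F powr (t / 4)"
    using N.exp_deviation_le[of s, unfolded a ax, folded F_def] assms s_pos by simp
  let ?E = "{\<omega> \<in> space P. norm ((1 / real n) *\<^sub>R (\<Sum>i=1..n. y i \<omega> \<otimes> y i \<omega>) - \<Lambda>) \<ge> t}"
  let ?E' = "{\<omega> \<in> space P. exp (s * N.deviation (U \<omega>)) \<ge> exp (x / 8)}"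
  \<comment> \<open>Off a null set the truncation changes nothing, so the events are compared almost
    surely.\<close>
  have "AE \<omega> in P. \<forall>i\<in>?I. norm (y i \<omega>) \<le> M"
    using assms(6) by (intro AE_finite_allI) auto
  then have "AE \<omega> in P. \<omega> \<in> ?E \<longrightarrow> \<omega> \<in> ?E'"
  proof eventually_elim
    case (elim \<omega>)
    have gram: "gram_op ?I (\<lambda>i. h (U \<omega> i)) = (\<Sum>i=1..n. y i \<omega> \<otimes> y i \<omega>)"
      unfolding gram_op_def by (intro sum.cong) (use elim in \<open>auto simp: h_def U_def\<close>)
    have "N.deviation (U \<omega>)
        = norm (real n *\<^sub>R ((1 / real n) *\<^sub>R (\<Sum>i=1..n. y i \<omega> \<otimes> y i \<omega>) - \<Lambda>))"
      unfolding N.deviation_def gram scaleR_diff_right using n_pos by simp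
    then have dev: "N.deviation (U \<omega>) = real n * norm ((1 / real n) *\<^sub>R (\<Sum>i=1..n. y i \<omega> \<otimes> y i \<omega>) - \<Lambda>)"
      by simp
    show ?case
    proof
      assume E: "\<omega> \<in> ?E"
      then have "real n * t \<le> N.deviation (U \<omega>)" unfolding dev by (simp add: mult_left_mono)
      then have "x / 8 \<le> s * N.deviation (U \<omega>)"
        unfolding sx[symmetric] using s_pos by (intro mult_left_mono) auto
      then show "\<omega> \<in> ?E'" using E by simp
    qed
  qed
  moreover have "?E' \<in> sets P"
    using borel_measurable_integrable[OF int] by measurable
  ultimately have "measure P ?E \<le> measure P ?E'"
    by (rule P.finite_measure_mono_AE)
  also have "\<dots> \<le> F / exp (x / 8)"
    unfolding F by (rule integral_Markov_inequality_measure[OF int, where A = "{}"]) auto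
  finally have "measure P ?E \<le> exp (- (x / 8)) * F"
    unfolding exp_minus divide_inverse by (simp only: mult.commute)
  then have "measure P ?E \<le> 2 powr (3 / 4) * real n * exp (- (x / 21))"
    using \<open>1 \<le> F\<close> assms
    by (intro tail_bound_from_self_bound[OF _ self]) (auto simp: x_def)
  then show ?thesis by (simp add: x_def mult.commute)
qed

end
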